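(* Let $f$ be a transcendental entire function with $\rho_2(f)<1$. Let $a$ and $b$ be small entire functions of $f$ such that $\rho(a)<\rho(f)$ and $a$ is a generalized Picard exceptional function of $f$. Suppose that $f'(z)$ and $f(z+1)$ share the function $b(z)$ CM. Then $f(z)=a(z)+p(z)e^{\beta z}$ and $\frac{f'(z)-b(z)}{f(z+1)-b(z)}=\frac{\beta}{e^{\beta}}$, where $\beta$ is a non-zero constant and $p$ is a non-zero polynomial with $\deg(p)=k\le 1$. If $k=1$, then $\beta=1$. Moreover, one of the following cases holds. (i) $a(z+1)\equiv b(z)$, and $a=b=0$. (ii) $a(z+1)\not\equiv b(z)$, and $\frac{a'-b}{a(z+1)-b}=\frac{\beta}{e^{\beta}}$. In particular, if $\frac{\beta}{e^{\beta}}=1$, then $a=0$ and $k=0$.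
   Context: Standard Nevanlinna theory notation is used: $T(r,f)$ is the Nevanlinna characteristic. For a meromorphic $f$, $\rho(f)=\limsup_{r\to\infty}\frac{\log^+T(r,f)}{\log r}$ is the order and $\rho_2(f)=\limsup_{r\to\infty}\frac{\log^+\log^+T(r,f)}{\log r}$ is the hyper-order. A meromorphic function $g$ is a small function of $f$ if $T(r,g)=o(T(r,f))$ as $r\to\infty$ outside a possible exceptional set of finite linear measure. A meromorphic function $a$ is a generalized Picard exceptional function of $f$ if $f-a$ has only finitely many zeros. Two functions $F,G$ share a function $b$ CM if $F-b$ and $G-b$ have the same zeros with the same multiplicities. *)

theory Defs
  imports "HOL-Complex_Analysis.Complex_Analysis" "HOL-Computational_Algebra.Polynomial"
begin

definition lnplus :: "real \<Rightarrow> real" where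
  "lnplus x = (if x \<le> 1 then 0 else ln x)"

text \<open>Nevanlinna characteristic of an entire function (no poles, so N(r,f) = 0 and
  T(r,f) = m(r,f), the proximity function).\<close>
definition nev_T :: "(complex \<Rightarrow> complex) \<Rightarrow> real \<Rightarrow> real" where
  "nev_T f r = (1 / (2 * pi)) * integral {0..2*pi} (\<lambda>\<theta>. lnplus (cmod (f (complex_of_real r * cis \<theta>))))"

definition nev_order :: "(complex \<Rightarrow> complex) \<Rightarrow> ereal" where
  "nev_order f = Limsup at_top (\<lambda>r::real. ereal (lnplus (nev_T f r) / ln r))"

definition nev_hyper_order :: "(complex \<Rightarrow> complex) \<Rightarrow> ereal" where
  "nev_hyper_order f = Limsup at_top (\<lambda>r::real. ereal (lnplus (lnplus (nev_T f r)) / ln r))"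

definition small_function :: "(complex \<Rightarrow> complex) \<Rightarrow> (complex \<Rightarrow> complex) \<Rightarrow> bool" where
  "small_function g f \<longleftrightarrow>
     (\<exists>E::real set. E \<in> sets lborel \<and> emeasure lborel E < \<infinity> \<and>
        (\<forall>\<epsilon>>0. \<exists>R. \<forall>r. r > R \<and> r \<notin> E \<longrightarrow> \<bar>nev_T g r\<bar> \<le> \<epsilon> * \<bar>nev_T f r\<bar>))"

definition entire :: "(complex \<Rightarrow> complex) \<Rightarrow> bool" where
  "entire f \<longleftrightarrow> f holomorphic_on UNIV"

definition transcendental_entire :: "(complex \<Rightarrow> complex) \<Rightarrow> bool" where
  "transcendental_entire f \<longleftrightarrow> entire f \<and> \<not> (\<exists>p. \<forall>z. f z = poly p z)"

definition gen_picard_exceptional :: "(complex \<Rightarrow> complex) \<Rightarrow> (complex \<Rightarrow> complex) \<Rightarrow> bool" where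
  "gen_picard_exceptional a f \<longleftrightarrow> finite {z. f z - a z = 0}"

definition share_CM :: "(complex \<Rightarrow> complex) \<Rightarrow> (complex \<Rightarrow> complex) \<Rightarrow> (complex \<Rightarrow> complex) \<Rightarrow> bool" where
  "share_CM F G b \<longleftrightarrow>
     (\<forall>z. (F z - b z = 0 \<longleftrightarrow> G z - b z = 0) \<and>
          (F z - b z = 0 \<longrightarrow> zorder (\<lambda>w. F w - b w) z = zorder (\<lambda>w. G w - b w) z))"

end

theory Submission
  imports Defs
begin

text \<open>
  Write \<open>f = a + p e\<^sup>h\<close> with a polynomial \<open>p\<close> and an entire \<open>h\<close>, and put \<open>w = e\<^sup>h\<close>. With
  \<open>A = a' - b\<close>, \<open>B = a(z+1) - b\<close>, \<open>P\<^sub>1 = p' + p h'\<close> and \<open>P\<^sub>2 = p(z+1) e\<^bsup>h(z+1) - h(z)\<^esup>\<close>, sharing \<open>b\<close> CM means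
  \<open>A + P\<^sub>1 w = E (B + P\<^sub>2 w)\<close> for a zero-free entire \<open>E\<close>. Hyper-order less than one provides radii \<open>\<rho>\<^sub>n\<close>
  with \<open>T(\<rho>\<^sub>n + n, w) \<le> 2 T(\<rho>\<^sub>n, w)\<close>; along them \<open>A\<close>, \<open>B\<close>, \<open>P\<^sub>1\<close>, \<open>P\<^sub>2\<close>, their derivatives and the logarithmic
  derivatives of \<open>w\<close> and \<open>E\<close> are all small compared with \<open>w\<close>, because Cauchy estimates and Harnack's
  inequality applied to a harmonic majorant of \<open>ln\<^sup>+ \<bar>g\<bar>\<close> on a slightly larger disc lose only constants.
  Neither the second main theorem nor the lemma on the logarithmic derivative is needed: by Jensen's
  inequality, \<open>1, w, w\<^sup>2\<close> are linearly independent over small functions. Eliminating \<open>w E\<close> between the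
  identity and its derivative yields such a relation, and hence \<open>P\<^sub>1 = E P\<^sub>2\<close> and \<open>A = E B\<close>. Growth then forces
  \<open>E e\<^bsup>h(z+1) - h(z)\<^esup>\<close> to be a constant \<open>\<beta>\<close>, so \<open>h' = \<beta>\<close> by Liouville's theorem and \<open>p' + \<beta> p = \<beta> p(z+1)\<close>.
\<close>

subsection \<open>Circle means\<close>

text \<open>Each estimate below enlarges the radius by a fixed amount: Cauchy's and Harnack's
  estimates, the shift by 1, and the crossing of an exceptional set of finite measure, which
  monotonicity of T allows within a fixed distance. A fast growing T could change its size even over
  such a step; hence the radii with windows of length n, which eventually contain every fixed step.
  Constant factors do no harm, since smallness is required for every \<epsilon>. What must be small
  and not merely bounded are h', Q' for \<open>E = e^Q\<close>, and
  \<open>e^(h(z+1) - h(z))\<close>. There the gradient estimate at distance s contributes a factor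
  1/s, and s may be as large as wished because the windows grow. This factor is the substitute for
  the lemma on the logarithmic derivative. Smallness relative to T cannot show that an exponent is
  constant. The last part therefore uses a second scale, characteristics of size o(r) for all large
  r; for h' this comes from the exponential growth bound by taking one logarithm.\<close>

definition cmean :: "(complex \<Rightarrow> real) \<Rightarrow> complex \<Rightarrow> real \<Rightarrow> real" where
  "cmean g c r = integral {0..2*pi} (\<lambda>t. g (c + of_real r * cis t)) / (2*pi)"

definition logp :: "(complex \<Rightarrow> complex) \<Rightarrow> complex \<Rightarrow> real" where
  "logp g z = lnplus (cmod (g z))"

lemma nev_T_eq_cmean: "nev_T g r = cmean (logp g) 0 r"
  by (simp add: nev_T_def cmean_def logp_def)

lemma cmean_integrable:
  fixes g :: "complex \<Rightarrow> real"
  assumes "continuous_on UNIV g"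
  shows "(\<lambda>t. g (c + of_real r * cis t)) integrable_on {0..2*pi}"
proof (rule integrable_continuous_real)
  show "continuous_on {0..2*pi} (\<lambda>t. g (c + of_real r * cis t))"
    by (rule continuous_on_compose2[OF assms]) (auto intro!: continuous_intros)
qed

lemma cmean_mono:
  assumes "continuous_on UNIV g" "continuous_on UNIV g'" "0 \<le> r"
    and "\<And>z. cmod (z - c) = r \<Longrightarrow> g z \<le> g' z"
  shows "cmean g c r \<le> cmean g' c r"
proof -
  have "integral {0..2*pi} (\<lambda>t. g (c + of_real r * cis t)) \<le> integral {0..2*pi} (\<lambda>t. g' (c + of_real r * cis t))"
    by (intro integral_le cmean_integrable assms) (simp_all add: norm_mult \<open>0 \<le> r\<close>)
  then show ?thesis by (simp add: cmean_def divide_right_mono)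
qed

lemma cmean_add:
  assumes "continuous_on UNIV g" "continuous_on UNIV g'"
  shows "cmean (\<lambda>z. g z + g' z) c r = cmean g c r + cmean g' c r"
  unfolding cmean_def
  by (subst integral_add) (auto intro!: cmean_integrable assms simp: add_divide_distrib)

lemma cmean_cmult: "cmean (\<lambda>z. k * g z) c r = k * cmean g c r"
  by (simp add: cmean_def)

lemma cmean_diff:
  assumes "continuous_on UNIV g" "continuous_on UNIV g'"
  shows "cmean (\<lambda>z. g z - g' z) c r = cmean g c r - cmean g' c r"
  unfolding cmean_def
  by (subst integral_diff) (auto intro!: cmean_integrable assms simp: diff_divide_distrib)

lemma cmean_const: "cmean (\<lambda>z. k) c r = k"
  by (simp add: cmean_def)

section \<open>Calculus of the positive part of the logarithm\<close>

lemma lnplus_nonneg [simp]: "0 \<le> lnplus x"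
  by (simp add: lnplus_def)

lemma lnplus_eq_max: "lnplus x = ln (max 1 x)"
  by (simp add: lnplus_def max_def)

lemma continuous_on_lnplus [continuous_intros]:
  "continuous_on S f \<Longrightarrow> continuous_on S (\<lambda>x. lnplus (f x))"
  unfolding lnplus_eq_max by (intro continuous_intros) auto

lemma lnplus_mono: "x \<le> y \<Longrightarrow> lnplus x \<le> lnplus y"
  by (simp add: lnplus_eq_max)

lemma lnplus_ge_ln: "0 < x \<Longrightarrow> ln x \<le> lnplus x"
  by (simp add: lnplus_eq_max)

lemma lnplus_exp [simp]: "lnplus (exp u) = max 0 u"
  by (simp add: lnplus_def)

lemma le_exp_lnplus: "x \<le> exp (lnplus x)"
  by (simp add: lnplus_def)

lemma lnplus_le_iff: "0 \<le> y \<Longrightarrow> lnplus x \<le> y \<longleftrightarrow> x \<le> exp y"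
  by (metis exp_le_cancel_iff le_exp_lnplus lnplus_exp lnplus_mono max.absorb2 order_trans)

lemma lnplus_mult: "0 \<le> x \<Longrightarrow> 0 \<le> y \<Longrightarrow> lnplus (x * y) \<le> lnplus x + lnplus y"
  by (subst lnplus_le_iff) (auto simp: exp_add intro!: mult_mono le_exp_lnplus)

lemma lnplus_add: "lnplus (x + y) \<le> lnplus x + lnplus y + ln 2"
proof (subst lnplus_le_iff)
  have "x \<le> exp (lnplus x + lnplus y)" "y \<le> exp (lnplus x + lnplus y)"
    by (rule order_trans[OF le_exp_lnplus], simp)+
  then show "x + y \<le> exp (lnplus x + lnplus y + ln 2)"
    by (simp add: exp_add)
qed auto

lemma lnplus_le_self: "0 \<le> x \<Longrightarrow> lnplus x \<le> x"
  by (subst lnplus_le_iff) (use exp_ge_add_one_self[of x] in linarith)+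

lemma logp_nonneg [simp]: "0 \<le> logp g z"
  by (simp add: logp_def)

lemma entire_continuous: "g holomorphic_on UNIV \<Longrightarrow> continuous_on UNIV g"
  by (rule holomorphic_on_imp_continuous_on)

lemma continuous_on_logp [continuous_intros]: "g holomorphic_on UNIV \<Longrightarrow> continuous_on UNIV (logp g)"
  unfolding logp_def [abs_def] by (intro continuous_intros holomorphic_on_imp_continuous_on)

lemma logp_mult: "logp (\<lambda>z. g z * h z) z \<le> logp g z + logp h z"
  by (simp add: logp_def norm_mult lnplus_mult)

lemma logp_add: "logp (\<lambda>z. g z + h z) z \<le> logp g z + logp h z + ln 2"
  unfolding logp_def by (rule order_trans[OF lnplus_mono[OF norm_triangle_ineq] lnplus_add])

lemma logp_exp: "logp (\<lambda>z. exp (h z)) z = max 0 (Re (h z))"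
  by (simp add: logp_def)

lemma le_logp: "cmod (g z) \<le> exp (logp g z)"
  by (simp add: logp_def le_exp_lnplus)

text \<open>No regularity of \<open>g\<close> is needed: a non-integrable integrand has integral 0
  by convention.\<close>

lemma nev_T_nonneg [simp]: "0 \<le> nev_T g r"
proof (cases "(\<lambda>\<theta>. lnplus (cmod (g (complex_of_real r * cis \<theta>)))) integrable_on {0..2*pi}")
  case True
  then have "0 \<le> integral {0..2*pi} (\<lambda>\<theta>. lnplus (cmod (g (complex_of_real r * cis \<theta>))))"
    by (rule integral_nonneg) auto
  then show ?thesis by (simp add: nev_T_def)
qed (simp add: nev_T_def not_integrable_integral)

text \<open>Cauchy's formula has the complex kernel 1/(u - z). The reflected point R^2 / cnj z lies
  outside the closed disc, so the term belonging to it integrates to 0; adding it makes the kernel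
  real, and on the circle, where \<open>u * cnj u\<close> is R^2, the sum is the Poisson
  kernel.\<close>

lemma Poisson_formula:
  fixes q :: "complex \<Rightarrow> complex"
  assumes q: "q holomorphic_on UNIV" and z: "cmod z < R"
  shows "((\<lambda>t. q (of_real R * cis t) * of_real ((R\<^sup>2 - (cmod z)\<^sup>2) / (cmod (of_real R * cis t - z))\<^sup>2))
          has_integral 2 * pi * q z) {0..2*pi}"
proof -
  have R: "R > 0" using z by (meson norm_ge_zero order_le_less_trans)
  have 1: "((\<lambda>u. q u / (u - z)) has_contour_integral (2 * pi * \<i> * q z)) (circlepath 0 R)"
    using Cauchy_integral_circlepath[of 0 R q z] q z
    by (auto intro: holomorphic_on_subset holomorphic_on_imp_continuous_on)
  \<comment> \<open>The modulus of the reflected point, so that the open disc of radius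
    \<open>d\<close> contains the circle but not the pole; for z = 0 there is no pole and any radius
    beyond R serves.\<close>
  define d where "d = (if z = 0 then 2 * R else R\<^sup>2 / cmod z)"
  have d: "d > R"
    using R z by (auto simp: d_def field_simps power2_eq_square)
  have nz: "of_real (R\<^sup>2) - cnj z * u \<noteq> 0" if "u \<in> ball 0 d" for u
  proof
    assume "of_real (R\<^sup>2) - cnj z * u = 0"
    then have "cmod (of_real (R\<^sup>2)) = cmod (cnj z * u)" by (metis eq_iff_diff_eq_0)
    then have e: "R\<^sup>2 = cmod z * cmod u" by (simp add: norm_mult norm_power)
    with R have "z \<noteq> 0" by auto
    with that e show False by (simp add: d_def field_simps)
  qed
  have 2: "((\<lambda>u. q u * cnj z / (of_real (R\<^sup>2) - cnj z * u)) has_contour_integral 0) (circlepath 0 R)"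
  proof (rule Cauchy_theorem_disc_simple[of _ 0 d])
    show "(\<lambda>u. q u * cnj z / (of_real (R\<^sup>2) - cnj z * u)) holomorphic_on ball 0 d"
      using nz by (intro holomorphic_intros holomorphic_on_subset[OF q]) auto
  qed (use d R in auto)
  have "((\<lambda>u. q u / (u - z) + q u * cnj z / (of_real (R\<^sup>2) - cnj z * u)) has_contour_integral (2 * pi * \<i> * q z)) (circlepath 0 R)"
    using has_contour_integral_add[OF 1 2] by simp
  then have "((\<lambda>t. (q (0 + R * cis t) / (0 + R * cis t - z) + q (0 + R * cis t) * cnj z / (of_real (R\<^sup>2) - cnj z * (0 + R * cis t))) * R * \<i> * cis t) has_integral (2 * pi * \<i> * q z)) {0..2*pi}"
    unfolding circlepath_def by (subst (asm) has_contour_integral_part_circlepath_iff) auto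
  then have "((\<lambda>t. -\<i> * ((q (0 + R * cis t) / (0 + R * cis t - z) + q (0 + R * cis t) * cnj z / (of_real (R\<^sup>2) - cnj z * (0 + R * cis t))) * R * \<i> * cis t)) has_integral -\<i> * (2 * pi * \<i> * q z)) {0..2*pi}"
    by (rule has_integral_mult_right)
  moreover have "-\<i> * ((q (0 + R * cis t) / (0 + R * cis t - z) + q (0 + R * cis t) * cnj z / (of_real (R\<^sup>2) - cnj z * (0 + R * cis t))) * R * \<i> * cis t)
     = q (R * cis t) * of_real ((R\<^sup>2 - (cmod z)\<^sup>2) / (cmod (R * cis t - z))\<^sup>2)" for t
  proof -
    define u where "u = of_real R * cis t"
    have mu: "u * cnj u = of_real (R\<^sup>2)"
      unfolding u_def by (simp add: power2_eq_square cis_cnj algebra_simps cis_mult)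
    have cu: "cmod u = R" using R by (simp add: u_def norm_mult)
    have uz: "u - z \<noteq> 0" using cu z by auto
    then have uz': "cnj u - cnj z \<noteq> 0" by (metis complex_cnj_diff complex_cnj_zero_iff)
    have u0: "u \<noteq> 0" using cu R by auto
    have "of_real (R\<^sup>2) - cnj z * u = u * (cnj u - cnj z)"
      unfolding mu[symmetric] by (simp add: algebra_simps)
    then have "(q u / (u - z) + q u * cnj z / (of_real (R\<^sup>2) - cnj z * u)) * u = q u * ((u * (cnj u - cnj z) + cnj z * (u - z)) / ((u - z) * (cnj u - cnj z)))"
      using uz uz' u0 by (simp add: divide_simps) (simp add: algebra_simps)
    also have "(u - z) * (cnj u - cnj z) = of_real ((cmod (u - z))\<^sup>2)"
      by (metis complex_cnj_diff complex_norm_square)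
    also have "u * (cnj u - cnj z) + cnj z * (u - z) = of_real (R\<^sup>2 - (cmod z)\<^sup>2)"
      by (simp add: algebra_simps complex_norm_square flip: mu del: of_real_power)
    finally show ?thesis by (simp add: u_def mult_ac)
  qed
  ultimately show ?thesis by (simp add: algebra_simps)
qed

lemma cmean_Re:
  fixes q :: "complex \<Rightarrow> complex"
  assumes q: "q holomorphic_on UNIV" and r: "0 \<le> r"
  shows "cmean (\<lambda>z. Re (q z)) c r = Re (q c)"
proof (cases "r = 0")
  case True
  then show ?thesis by (simp add: cmean_def)
next
  case False
  with r have r: "r > 0" by simp
  have "(\<lambda>z. q (c + z)) holomorphic_on UNIV"
    by (intro holomorphic_on_compose[OF _ holomorphic_on_subset[OF q], unfolded o_def] holomorphic_intros) auto
  from Poisson_formula[OF this, of 0 r] r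
  have "((\<lambda>t. q (c + of_real r * cis t)) has_integral 2 * pi * q c) {0..2*pi}"
    by (simp add: norm_mult)
  from has_integral_Re[OF this] have "integral {0..2*pi} (\<lambda>t. Re (q (c + of_real r * cis t))) = 2 * pi * Re (q c)"
    by (simp add: integral_unique)
  then show ?thesis by (simp add: cmean_def)
qed

text \<open>On the circle |u - z| is at least R - |z|, which bounds the Poisson kernel by the stated
  quotient; nonnegativity on the circle lets this bound pass under the integral.\<close>

lemma Harnack:
  fixes q :: "complex \<Rightarrow> complex"
  assumes q: "q holomorphic_on UNIV" and z: "cmod z < R"
    and pos: "\<And>u. cmod u = R \<Longrightarrow> 0 \<le> Re (q u)"
  shows "Re (q z) \<le> (R + cmod z) / (R - cmod z) * Re (q 0)"
proof -
  have R: "R > 0" using z by (meson norm_ge_zero order_le_less_trans)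
  let ?k = "\<lambda>t. (R\<^sup>2 - (cmod z)\<^sup>2) / (cmod (of_real R * cis t - z))\<^sup>2"
  have 1: "((\<lambda>t. Re (q (of_real R * cis t)) * ?k t) has_integral 2 * pi * Re (q z)) {0..2*pi}"
    using has_integral_Re[OF Poisson_formula[OF q z]] by (simp del: of_real_divide of_real_diff of_real_power)
  have 2: "((\<lambda>t. (R + cmod z) / (R - cmod z) * Re (q (of_real R * cis t))) has_integral (R + cmod z) / (R - cmod z) * (2 * pi * Re (q 0))) {0..2*pi}"
    using has_integral_Re[OF Poisson_formula[OF q, of 0 R]] R
    by (intro has_integral_mult_right) (simp add: norm_mult)
  have k: "?k t \<le> (R + cmod z) / (R - cmod z)" for t
  proof -
    have le: "R - cmod z \<le> cmod (of_real R * cis t - z)"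
      using norm_triangle_ineq2[of "of_real R * cis t" z] R by (simp add: norm_mult)
    have "?k t \<le> (R\<^sup>2 - (cmod z)\<^sup>2) / (R - cmod z)\<^sup>2"
      using z le R by (intro divide_left_mono power_mono mult_pos_pos zero_less_power) (auto simp: power_mono)
    also have "\<dots> = (R + cmod z) / (R - cmod z)"
      using z by (simp add: power2_eq_square square_diff_square_factored)
    finally show ?thesis .
  qed
  have "2 * pi * Re (q z) \<le> (R + cmod z) / (R - cmod z) * (2 * pi * Re (q 0))"
  proof (rule has_integral_le[OF 1 2])
    fix t
    show "Re (q (of_real R * cis t)) * ?k t \<le> (R + cmod z) / (R - cmod z) * Re (q (of_real R * cis t))"
      using mult_left_mono[OF k pos[of "of_real R * cis t"]] R by (simp add: norm_mult mult_ac)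
  qed
  also have "\<dots> = 2 * pi * ((R + cmod z) / (R - cmod z) * Re (q 0))" by simp
  finally show ?thesis by (subst (asm) mult_le_cancel_left_pos) auto
qed

text \<open>Cauchy's formula for q' involves all of q. The integral of q(u) e^(it) vanishes, and so
  does its conjugate; adding the latter replaces q by q + cnj q, so that only the real part is
  left.\<close>

lemma gradient_bound:
  fixes q :: "complex \<Rightarrow> complex"
  assumes q: "q holomorphic_on UNIV" and s: "s > 0"
  shows "cmod (deriv q c) \<le> 2 / s * cmean (\<lambda>z. \<bar>Re (q z)\<bar>) c s"
proof -
  let ?u = "\<lambda>t. c + of_real s * cis t"
  have "((\<lambda>u. q u / (u - c) ^ Suc 1) has_contour_integral (2 * pi * \<i>) / fact 1 * (deriv ^^ 1) q c) (circlepath c s)"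
    by (rule Cauchy_has_contour_integral_higher_derivative_circlepath)
       (use q s in \<open>auto intro: holomorphic_on_subset holomorphic_on_imp_continuous_on\<close>)
  then have "((\<lambda>t. q (?u t) / (?u t - c) ^ Suc 1 * s * \<i> * cis t) has_integral (2 * pi * \<i>) / fact 1 * (deriv ^^ 1) q c) {0..2*pi}"
    unfolding circlepath_def by (subst (asm) has_contour_integral_part_circlepath_iff) auto
  from has_integral_mult_right[OF this, of "-\<i> * s"]
  have 1: "((\<lambda>t. q (?u t) * cis (-t)) has_integral 2 * pi * s * deriv q c) {0..2*pi}"
    using s by (simp add: field_simps power2_eq_square flip: cis_inverse)
  have "(q has_contour_integral 0) (circlepath c s)"
    by (rule Cauchy_theorem_disc_simple[of _ c "s+1"]) (use q s in \<open>auto intro: holomorphic_on_subset\<close>)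
  then have "((\<lambda>t. q (?u t) * s * \<i> * cis t) has_integral 0) {0..2*pi}"
    unfolding circlepath_def by (subst (asm) has_contour_integral_part_circlepath_iff) auto
  from has_integral_mult_right[OF this, of "-\<i> / s"]
  have "((\<lambda>t. q (?u t) * cis t) has_integral 0) {0..2*pi}"
    using s by (simp add: field_simps)
  from has_integral_linear[OF this bounded_linear_cnj]
  have 2: "((\<lambda>t. cnj (q (?u t)) * cis (-t)) has_integral 0) {0..2*pi}"
    by (simp add: o_def cis_cnj)
  have "((\<lambda>t. q (?u t) * cis (-t) + cnj (q (?u t)) * cis (-t)) has_integral 2 * pi * s * deriv q c) {0..2*pi}"
    using has_integral_add[OF 1 2] by simp
  moreover have "q (?u t) * cis (-t) + cnj (q (?u t)) * cis (-t) = 2 * of_real (Re (q (?u t))) * cis (-t)" for t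
    by (metis complex_add_cnj distrib_right of_real_mult of_real_numeral)
  ultimately have 3: "((\<lambda>t. 2 * of_real (Re (q (?u t))) * cis (-t)) has_integral 2 * pi * s * deriv q c) {0..2*pi}"
    by simp
  have c: "continuous_on UNIV (\<lambda>z. \<bar>Re (q z)\<bar>)" "continuous_on UNIV q"
    using entire_continuous[OF q] by (auto intro!: continuous_intros)
  have "norm (integral {0..2*pi} (\<lambda>t. 2 * of_real (Re (q (?u t))) * cis (-t))) \<le> integral {0..2*pi} (\<lambda>t. 2 * \<bar>Re (q (?u t))\<bar>)"
    by (rule integral_norm_bound_integral)
       (auto simp: norm_mult intro: has_integral_integrable[OF 3] integrable_cmul intro!: integrable_on_mult_right cmean_integrable c)
  then have "2 * pi * s * cmod (deriv q c) \<le> 2 * (2 * pi * cmean (\<lambda>z. \<bar>Re (q z)\<bar>) c s)"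
    using s by (simp add: integral_unique[OF 3] cmean_def norm_mult)
  then show ?thesis using s by (simp add: field_simps)
qed

subsection \<open>Harmonic majorants\<close>

text \<open>Trigonometric polynomials on the circle \<open>\<bar>z\<bar> = R\<close> as Laurent polynomials.\<close>
definition laurent_on_sphere :: "real \<Rightarrow> (complex \<Rightarrow> real) \<Rightarrow> bool" where
  "laurent_on_sphere R g \<longleftrightarrow> (\<exists>N q. \<forall>z. cmod z = R \<longrightarrow> of_real (g z) = poly q z / z ^ N)"

text \<open>On the circle \<open>cnj z\<close> equals R^2 / z, so real-linear functions
  \<open>\<alpha> * z + \<gamma> * cnj z\<close> become Laurent polynomials, and these are closed
  under sums and products.\<close>

lemma real_polynomial_laurent_on_sphere:
  assumes "real_polynomial_function g" and R: "R > 0"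
  shows "laurent_on_sphere R g"
  using assms(1)
proof induction
  case (linear g)
  then interpret bounded_linear g .
  define \<alpha> where "\<alpha> = (of_real (g 1) - \<i> * of_real (g \<i>)) / 2"
  define \<gamma> where "\<gamma> = (of_real (g 1) + \<i> * of_real (g \<i>)) / 2"
  define \<beta> where "\<beta> = of_real (R\<^sup>2) * \<gamma>"
  have "of_real (g z) = poly [:\<beta>, 0, \<alpha>:] z / z ^ 1" if z: "cmod z = R" for z
  proof -
    have z0: "z \<noteq> 0" using z R by auto
    have c: "of_real (R\<^sup>2) = z * cnj z" using complex_norm_square[of z] by (simp add: z)
    have "g z = g (Re z *\<^sub>R 1 + Im z *\<^sub>R \<i>)"
      by (rule arg_cong[of _ _ g]) (simp add: complex_eq_iff)
    also have "\<dots> = Re z * g 1 + Im z * g \<i>" by (simp only: add scaleR real_scaleR_def)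
    finally have "complex_of_real (g z) = of_real (Re z) * of_real (g 1) + of_real (Im z) * of_real (g \<i>)" by simp
    also have "complex_of_real (Re z) = (z + cnj z) / 2" by (simp add: complex_eq_iff)
    also have "complex_of_real (Im z) = - \<i> * (z - cnj z) / 2" by (simp add: complex_eq_iff)
    finally have "complex_of_real (g z) = \<alpha> * z + \<gamma> * cnj z"
      by (simp add: \<alpha>_def \<gamma>_def field_simps)
    also have "\<dots> = poly [:\<beta>, 0, \<alpha>:] z / z ^ 1"
      unfolding \<beta>_def c using z0 by (simp add: field_simps power2_eq_square)
    finally show ?thesis .
  qed
  then show ?case unfolding laurent_on_sphere_def by blast
next
  case (const c)
  have "\<forall>z. cmod z = R \<longrightarrow> of_real c = poly [:of_real c:] z / z ^ 0" by simp
  then show ?case unfolding laurent_on_sphere_def by blast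
next
  case (add f g)
  then obtain N p M q where "\<forall>z. cmod z = R \<longrightarrow> of_real (f z) = poly p z / z ^ N"
    "\<forall>z. cmod z = R \<longrightarrow> of_real (g z) = poly q z / z ^ M" unfolding laurent_on_sphere_def by blast
  then have "of_real (f z + g z) = poly (p * monom 1 M + q * monom 1 N) z / z ^ (N + M)" if "cmod z = R" for z
    using that R by (auto simp: poly_monom field_simps power_add)
  then show ?case unfolding laurent_on_sphere_def by blast
next
  case (mult f g)
  then obtain N p M q where "\<forall>z. cmod z = R \<longrightarrow> of_real (f z) = poly p z / z ^ N"
    "\<forall>z. cmod z = R \<longrightarrow> of_real (g z) = poly q z / z ^ M" unfolding laurent_on_sphere_def by blast
  then have "of_real (f z * g z) = poly (p * q) z / z ^ (N + M)" if "cmod z = R" for z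
    using that by (auto simp: power_add)
  then show ?case unfolding laurent_on_sphere_def by blast
qed

text \<open>This solves the Dirichlet problem for trigonometric polynomials. Conjugation does not
  change a real part, and on the circle it turns c z^(-k) into cnj c z^k / R^(2k), so negative
  powers disappear.\<close>

lemma laurent_on_sphere_Re_entire:
  assumes "laurent_on_sphere R g" and R: "R > 0"
  obtains h where "h holomorphic_on UNIV" "\<And>z. cmod z = R \<Longrightarrow> g z = Re (h z)"
proof -
  obtain N q where q: "\<And>z. cmod z = R \<Longrightarrow> of_real (g z) = poly q z / z ^ N"
    using assms unfolding laurent_on_sphere_def by blast
  define h where "h z = (\<Sum>i\<le>degree q. if N \<le> i then coeff q i * z ^ (i - N)
      else cnj (coeff q i) * z ^ (N - i) / of_real (R ^ (2 * (N - i))))" for z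
  show ?thesis
  proof
    have "(\<lambda>z. if N \<le> i then coeff q i * z ^ (i - N)
      else cnj (coeff q i) * z ^ (N - i) / of_real (R ^ (2 * (N - i)))) holomorphic_on UNIV" for i
      using R by (cases "N \<le> i") (auto intro!: holomorphic_intros)
    then show "h holomorphic_on UNIV"
      unfolding h_def by (intro holomorphic_on_sum)
  next
    fix z assume z: "cmod z = R"
    then have z0: "z \<noteq> 0" using R by auto
    have "g z = Re (of_real (g z))" by simp
    also have "\<dots> = Re (poly q z / z ^ N)" using q[OF z] by simp
    also have "\<dots> = (\<Sum>i\<le>degree q. Re (coeff q i * z ^ i / z ^ N))"
      by (simp add: poly_altdef sum_divide_distrib)
    also have "\<dots> = (\<Sum>i\<le>degree q. Re (if N \<le> i then coeff q i * z ^ (i - N)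
      else cnj (coeff q i) * z ^ (N - i) / of_real (R ^ (2 * (N - i)))))"
    proof (rule sum.cong)
      fix i
      show "Re (coeff q i * z ^ i / z ^ N) = Re (if N \<le> i then coeff q i * z ^ (i - N)
        else cnj (coeff q i) * z ^ (N - i) / of_real (R ^ (2 * (N - i))))"
      proof (cases "N \<le> i")
        case True
        then show ?thesis using z0 by (simp add: power_diff)
      next
        case False
        have "coeff q i * z ^ i / z ^ N = coeff q i / z ^ (N - i)"
          using False z0 by (simp add: power_diff)
        also have "\<dots> = coeff q i * cnj z ^ (N - i) / (z * cnj z) ^ (N - i)"
          using z0 by (simp add: power_mult_distrib)
        also have "z * cnj z = of_real (R ^ 2)" using complex_norm_square[of z] by (simp add: z)
        finally have e: "coeff q i * z ^ i / z ^ N = coeff q i * cnj z ^ (N - i) / of_real (R ^ (2 * (N - i)))"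
          by (simp add: power_mult)
        have "Re (coeff q i * z ^ i / z ^ N) = Re (cnj (coeff q i * cnj z ^ (N - i) / of_real (R ^ (2 * (N - i)))))"
          unfolding e by (rule cnj.sel(1)[symmetric])
        then show ?thesis using False by simp
      qed
    qed simp
    also have "\<dots> = Re (h z)" by (simp add: h_def)
    finally show "g z = Re (h z)" .
  qed
qed

text \<open>Stone-Weierstrass replaces the boundary values of \<open>logp g\<close> by a polynomial,
  for which the Dirichlet problem is solved explicitly; the price is the error \<open>e\<close>. The
  maximum principle for g e^(-q) and for -q carries the bound, including its nonnegative part, into
  the disc.\<close>

lemma harmonic_majorant:
  assumes g: "g holomorphic_on UNIV" and R: "R > 0" and e: "e > 0"
  obtains q where "q holomorphic_on UNIV" "\<And>z. cmod z \<le> R \<Longrightarrow> logp g z \<le> Re (q z)"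
    "Re (q 0) \<le> nev_T g R + e"
proof -
  have cl: "continuous_on UNIV (logp g)" by (intro continuous_intros g)
  obtain t where t: "real_polynomial_function t" "\<And>z. z \<in> sphere 0 R \<Longrightarrow> \<bar>logp g z - t z\<bar> < e / 2"
    by (rule Stone_Weierstrass_real_polynomial_function[of "sphere (0::complex) R" "logp g" "e/2"])
       (use cl e in \<open>auto intro: continuous_on_subset\<close>)
  obtain h where h: "h holomorphic_on UNIV" "\<And>z. cmod z = R \<Longrightarrow> t z = Re (h z)"
    using laurent_on_sphere_Re_entire[OF real_polynomial_laurent_on_sphere[OF t(1) R] R] by blast
  \<comment> \<open>The added e/2 turns the two-sided approximation into a bound from above.\<close>
  define q where "q z = h z + of_real (e / 2)" for z
  have q: "q holomorphic_on UNIV" unfolding q_def by (intro holomorphic_intros h)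
  have cq: "continuous_on UNIV (\<lambda>z. Re (q z))" by (intro continuous_intros entire_continuous q)
  have bd: "logp g z \<le> Re (q z)" "Re (q z) \<le> logp g z + e" if "cmod z = R" for z
  proof -
    have "\<bar>logp g z - Re (h z)\<bar> < e / 2" "Re (q z) = Re (h z) + e / 2"
      using t(2)[of z] h(2)[of z] that by (auto simp: q_def)
    then show "logp g z \<le> Re (q z)" "Re (q z) \<le> logp g z + e" by linarith+
  qed
  show ?thesis
  proof
    show "q holomorphic_on UNIV" by fact
    show "logp g z \<le> Re (q z)" if "cmod z \<le> R" for z
    proof -
      have "cmod (g z * exp (- q z)) \<le> 1"
      proof (rule maximum_modulus_frontier[of "\<lambda>z. g z * exp (- q z)" "cball 0 R"])
        have h: "(\<lambda>z. g z * exp (- q z)) holomorphic_on UNIV" by (intro holomorphic_intros g q)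
        show "(\<lambda>z. g z * exp (- q z)) holomorphic_on interior (cball 0 R)" by (rule holomorphic_on_subset[OF h]) auto
        show "continuous_on (closure (cball 0 R)) (\<lambda>z. g z * exp (- q z))"
          by (rule continuous_on_subset[OF entire_continuous[OF h]]) auto
        fix w assume "w \<in> frontier (cball (0::complex) R)"
        then have "cmod w = R" using R by auto
        then have "cmod (g w) \<le> exp (Re (q w))" using le_logp[of g w] bd(1)[of w] by (meson exp_le_cancel_iff order_trans)
        then show "cmod (g w * exp (- q w)) \<le> 1" by (simp add: norm_mult norm_divide exp_minus field_simps)
      qed (use that in auto)
      then have 1: "cmod (g z) \<le> exp (Re (q z))" by (simp add: norm_mult norm_divide exp_minus field_simps)
      have "Re (- q z) \<le> 0"
      proof (rule maximum_real_frontier[of "\<lambda>z. - q z" "cball 0 R"])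
        show "(\<lambda>z. - q z) holomorphic_on interior (cball 0 R)" by (intro holomorphic_intros holomorphic_on_subset[OF q]) auto
        show "continuous_on (closure (cball 0 R)) (\<lambda>z. - q z)"
          by (intro continuous_intros continuous_on_subset[OF entire_continuous[OF q]]) auto
        fix w assume "w \<in> frontier (cball (0::complex) R)"
        then have "cmod w = R" using R by auto
        then show "Re (- q w) \<le> 0" using bd(1)[of w] order_trans[OF logp_nonneg[of g w]] by simp
      qed (use that in auto)
      with 1 show ?thesis by (simp add: logp_def lnplus_le_iff)
    qed
    have "Re (q 0) = cmean (\<lambda>z. Re (q z)) 0 R" using cmean_Re[OF q, of R 0] R by simp
    also have "\<dots> \<le> cmean (\<lambda>z. logp g z + e) 0 R"
      by (rule cmean_mono) (use bd R cq in \<open>auto intro!: continuous_intros g\<close>)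
    also have "\<dots> = nev_T g R + e"
      by (subst cmean_add) (auto intro!: continuous_intros g simp: cmean_const nev_T_eq_cmean)
    finally show "Re (q 0) \<le> nev_T g R + e" .
  qed
qed

lemma harmonic_majorant_nonneg:
  assumes "\<And>z. cmod z \<le> R \<Longrightarrow> logp g z \<le> Re (q z)" "cmod z \<le> R"
  shows "0 \<le> Re (q z)"
  using assms(1)[OF assms(2)] logp_nonneg[of g z] by linarith

text \<open>The mean of the majorant over the off-centre circle is its value at \<open>c\<close>,
  and Harnack compares this with the value at 0. With r = 0 the lemma bounds \<open>logp g\<close>
  pointwise, with c = 0 it gives monotonicity of the characteristic.\<close>

lemma cmean_logp_shift:
  assumes g: "g holomorphic_on UNIV" and "0 \<le> r" "cmod c + r \<le> R" "cmod c < R"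
  shows "cmean (logp g) c r \<le> (R + cmod c) / (R - cmod c) * nev_T g R"
proof (rule field_le_epsilon)
  fix e :: real assume e: "e > 0"
  define K where "K = (R + cmod c) / (R - cmod c)"
  have R: "R > 0" using assms by (meson norm_ge_zero order_le_less_trans)
  have K: "K > 0" using assms R by (auto simp: K_def intro!: divide_pos_pos add_pos_nonneg)
  obtain q where q: "q holomorphic_on UNIV" "\<And>z. cmod z \<le> R \<Longrightarrow> logp g z \<le> Re (q z)"
    "Re (q 0) \<le> nev_T g R + e / K" using harmonic_majorant[OF g R, of "e / K"] e K by auto
  have "cmean (logp g) c r \<le> cmean (\<lambda>z. Re (q z)) c r"
  proof (rule cmean_mono)
    show "logp g z \<le> Re (q z)" if "cmod (z - c) = r" for z
      using q(2)[of z] that assms norm_triangle_ineq[of c "z - c"] by auto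
  qed (use assms in \<open>auto intro!: continuous_intros g entire_continuous q\<close>)
  also have "\<dots> = Re (q c)" by (rule cmean_Re) (use assms q in auto)
  also have "\<dots> \<le> K * Re (q 0)" unfolding K_def
    by (rule Harnack) (use assms q harmonic_majorant_nonneg[OF q(2)] in auto)
  also have "\<dots> \<le> K * (nev_T g R + e / K)" using q(3) K by (intro mult_left_mono) auto
  also have "\<dots> = K * nev_T g R + e" using K by (simp add: field_simps)
  finally show "cmean (logp g) c r \<le> K * nev_T g R + e" .
qed

lemma logp_le_nev_T:
  assumes "g holomorphic_on UNIV" "cmod z < R"
  shows "logp g z \<le> (R + cmod z) / (R - cmod z) * nev_T g R"
  using cmean_logp_shift[OF assms(1), of 0 z R] assms(2) by (simp add: cmean_const cmean_def)

lemma logp_le_3_nev_T: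
  assumes "g holomorphic_on UNIV" "z \<noteq> 0"
  shows "logp g z \<le> 3 * nev_T g (2 * cmod z)"
  using logp_le_nev_T[of g z "2 * cmod z"] assms by simp

section \<open>Monotonicity, shifts and arithmetic of the characteristic\<close>

lemma nev_T_mono:
  assumes "g holomorphic_on UNIV" "0 \<le> r" "r \<le> R"
  shows "nev_T g r \<le> nev_T g R"
  using cmean_logp_shift[OF assms(1,2), of 0 R] assms
  by (cases "R = 0") (auto simp: nev_T_eq_cmean)

lemma cmean_shift: "cmean g c r = cmean (\<lambda>z. g (z + c)) 0 r"
  by (simp add: cmean_def add_ac)

text \<open>The circle of radius r about 1 lies in the disc of radius r + 1, where the Harnack
  factor is (r + 2) / r, at most 2 from r = 2 on.\<close>

lemma nev_T_shift:
  assumes "g holomorphic_on UNIV" "2 \<le> r"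
  shows "nev_T (\<lambda>z. g (z + 1)) r \<le> 2 * nev_T g (r + 1)"
proof -
  have "nev_T (\<lambda>z. g (z + 1)) r = cmean (logp g) 1 r"
    by (simp add: nev_T_eq_cmean cmean_shift[of _ 1] logp_def [abs_def])
  also have "\<dots> \<le> (r + 1 + cmod 1) / (r + 1 - cmod 1) * nev_T g (r + 1)"
    by (rule cmean_logp_shift) (use assms in auto)
  also have "\<dots> \<le> 2 * nev_T g (r + 1)"
    using assms by (intro mult_right_mono) (auto simp: field_simps)
  finally show ?thesis .
qed

lemma nev_T_add:
  assumes "g holomorphic_on UNIV" "h holomorphic_on UNIV" "0 \<le> r"
  shows "nev_T (\<lambda>z. g z + h z) r \<le> nev_T g r + nev_T h r + ln 2"
proof -
  have "nev_T (\<lambda>z. g z + h z) r \<le> cmean (\<lambda>z. logp g z + logp h z + ln 2) 0 r"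
    unfolding nev_T_eq_cmean
    by (rule cmean_mono) (auto intro!: continuous_intros holomorphic_intros assms logp_add)
  also have "\<dots> = nev_T g r + nev_T h r + ln 2"
    by (simp add: cmean_add continuous_intros assms cmean_const nev_T_eq_cmean)
  finally show ?thesis .
qed

lemma nev_T_mult:
  assumes "g holomorphic_on UNIV" "h holomorphic_on UNIV" "0 \<le> r"
  shows "nev_T (\<lambda>z. g z * h z) r \<le> nev_T g r + nev_T h r"
proof -
  have "nev_T (\<lambda>z. g z * h z) r \<le> cmean (\<lambda>z. logp g z + logp h z) 0 r"
    unfolding nev_T_eq_cmean
    by (rule cmean_mono) (auto intro!: continuous_intros holomorphic_intros assms logp_mult)
  also have "\<dots> = nev_T g r + nev_T h r"
    by (simp add: cmean_add continuous_intros assms nev_T_eq_cmean)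
  finally show ?thesis .
qed

lemma nev_T_minus: "nev_T (\<lambda>z. - g z) r = nev_T g r"
  by (simp add: nev_T_def)

lemma nev_T_const: "nev_T (\<lambda>z. c) r = lnplus (cmod c)"
  by (simp add: nev_T_def)

lemma nev_T_ident: "0 \<le> r \<Longrightarrow> nev_T (\<lambda>z. z) r = lnplus r"
  by (simp add: nev_T_def norm_mult)

text \<open>Harnack's inequality in the disc of radius 2 about \<open>z\<close>, at distance at most
  1 from its centre: (2 + 1) / (2 - 1) = 3.\<close>

lemma Harnack_unit_disc:
  assumes q: "q holomorphic_on UNIV" and pos: "\<And>u. cmod u \<le> R \<Longrightarrow> 0 \<le> Re (q u)"
    and "cmod z + 2 \<le> R" "cmod (w - z) \<le> 1"
  shows "Re (q w) \<le> 3 * Re (q z)"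
proof -
  have "(\<lambda>u. q (z + u)) holomorphic_on UNIV"
    by (intro holomorphic_on_compose[OF _ holomorphic_on_subset[OF q], unfolded o_def] holomorphic_intros) auto
  then have "Re (q (z + (w - z))) \<le> (2 + cmod (w - z)) / (2 - cmod (w - z)) * Re (q (z + 0))"
  proof (rule Harnack)
    show "0 \<le> Re (q (z + u))" if "cmod u = 2" for u
      using pos[of "z + u"] norm_triangle_ineq[of z u] that assms by auto
  qed (use assms in auto)
  also have "\<dots> \<le> 3 * Re (q (z + 0))"
  proof (rule mult_right_mono)
    show "(2 + cmod (w - z)) / (2 - cmod (w - z)) \<le> 3" using assms by (simp add: field_simps)
    show "0 \<le> Re (q (z + 0))" using pos[of z] assms by auto
  qed
  finally show ?thesis by simp
qed

text \<open>Cauchy's estimate on the unit circle about z, on which the majorant is at most three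
  times its value at z. The disc of radius 2 needed for that accounts for r + 2.\<close>

lemma nev_T_deriv:
  assumes g: "g holomorphic_on UNIV" and r: "0 \<le> r"
  shows "nev_T (deriv g) r \<le> 3 * nev_T g (r + 2)"
proof (rule field_le_epsilon)
  fix e :: real assume e: "e > 0"
  obtain q where q: "q holomorphic_on UNIV" "\<And>z. cmod z \<le> r + 2 \<Longrightarrow> logp g z \<le> Re (q z)"
    "Re (q 0) \<le> nev_T g (r + 2) + e / 3" using harmonic_majorant[OF g, of "r + 2" "e / 3"] e r by auto
  have g': "deriv g holomorphic_on UNIV" using g by (intro holomorphic_intros) auto
  have "nev_T (deriv g) r \<le> cmean (\<lambda>z. 3 * Re (q z)) 0 r"
    unfolding nev_T_eq_cmean
  proof (rule cmean_mono)
    fix z :: complex assume z: "cmod (z - 0) = r"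
    have "cmod ((deriv ^^ 1) g z) \<le> fact 1 * exp (3 * Re (q z)) / 1 ^ 1"
    proof (rule Cauchy_inequality)
      fix x assume "cmod (z - x) = 1"
      then have x: "cmod (x - z) = 1" by (simp add: norm_minus_commute)
      have "cmod x \<le> r + 2" using norm_triangle_ineq[of z "x - z"] x z by auto
      then have "logp g x \<le> Re (q x)" by (rule q(2))
      also have "\<dots> \<le> 3 * Re (q z)"
        by (rule Harnack_unit_disc[OF q(1) harmonic_majorant_nonneg[OF q(2)]]) (use x z in auto)
      finally show "cmod (g x) \<le> exp (3 * Re (q z))" using le_logp[of g x] by (meson exp_le_cancel_iff order_trans)
    qed (use g in \<open>auto intro: holomorphic_on_subset holomorphic_on_imp_continuous_on\<close>)
    moreover have "0 \<le> Re (q z)" using harmonic_majorant_nonneg[OF q(2)] z by auto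
    ultimately show "logp (deriv g) z \<le> 3 * Re (q z)" by (simp add: logp_def lnplus_le_iff)
  qed (use r in \<open>auto intro!: continuous_intros g' entire_continuous q\<close>)
  also have "\<dots> = 3 * Re (q 0)" using cmean_Re[OF q(1) r] by (simp add: cmean_cmult)
  finally show "nev_T (deriv g) r \<le> 3 * nev_T g (r + 2) + e" using q(3) by simp
qed

subsection \<open>Zeros and Jensen's inequality\<close>

text \<open>The exponent may be 0, so \<open>a\<close> need not be a zero. The cofactor is glued
  from the local factor near \<open>a\<close> and the quotient away from \<open>a\<close>.\<close>

lemma entire_factor_zero:
  fixes X :: "complex \<Rightarrow> complex"
  assumes X: "X holomorphic_on UNIV" and "X w \<noteq> 0"
  obtains n Y where "Y holomorphic_on UNIV" "Y a \<noteq> 0" "\<And>z. X z = (z - a) ^ n * Y z"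
proof -
  define n where "n = nat (zorder X a)"
  obtain r where r: "r > 0" "zor_poly X a holomorphic_on cball a r"
      "\<And>w. w \<in> cball a r \<Longrightarrow> X w = zor_poly X a w * (w - a) ^ n \<and> zor_poly X a w \<noteq> 0"
    using zorder_exist_zero[OF X open_UNIV connected_UNIV UNIV_I[of a]] assms(2) unfolding n_def by blast
  define Y where "Y z = (if z \<in> ball a r then zor_poly X a z else X z / (z - a) ^ n)" for z
  have 1: "Y holomorphic_on ball a r"
    using r(2) by (rule holomorphic_transform[OF holomorphic_on_subset]) (auto simp: Y_def)
  have eq: "Y z = X z / (z - a) ^ n" if "z \<noteq> a" for z
    using r(3)[of z] that by (auto simp: Y_def)
  have "(\<lambda>z. X z / (z - a) ^ n) holomorphic_on - {a}"
    by (intro holomorphic_intros holomorphic_on_subset[OF X]) auto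
  then have 2: "Y holomorphic_on - {a}"
    by (rule holomorphic_transform) (use eq in auto)
  have "Y holomorphic_on (ball a r \<union> - {a})"
    by (rule holomorphic_on_Un[OF 1 2]) auto
  moreover have "ball a r \<union> - {a} = UNIV" using r(1) by auto
  ultimately have "Y holomorphic_on UNIV" by simp
  moreover have "Y a \<noteq> 0" using r by (auto simp: Y_def)
  moreover have "X z = (z - a) ^ n * Y z" for z
    using r(1) r(3)[of a] eq[of z] by (cases "z = a") (auto simp: Y_def)
  ultimately show ?thesis using that by blast
qed

lemma entire_finite_zeros_factor:
  fixes X :: "complex \<Rightarrow> complex"
  assumes "X holomorphic_on UNIV" "finite {z. X z = 0}"
  shows "\<exists>p Y. p \<noteq> 0 \<and> Y holomorphic_on UNIV \<and> (\<forall>z. Y z \<noteq> 0) \<and> (\<forall>z. X z = poly p z * Y z)"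
  using assms
proof (induction "card {z. X z = 0}" arbitrary: X rule: less_induct)
  case less
  show ?case
  proof (cases "{z. X z = 0} = {}")
    case True
    then show ?thesis using less.prems by (intro exI[of _ 1] exI[of _ X]) auto
  next
    case False
    then obtain a where a: "X a = 0" by auto
    have "{z. X z = 0} \<noteq> UNIV" using less.prems(2) infinite_UNIV_char_0 by metis
    then obtain w where "X w \<noteq> 0" by auto
    then obtain n Y where Y: "Y holomorphic_on UNIV" "Y a \<noteq> 0" "\<And>z. X z = (z - a) ^ n * Y z"
      using entire_factor_zero[OF less.prems(1)] by metis
    have "{z. Y z = 0} \<subset> {z. X z = 0}" using Y a by auto
    with less.prems(2) have "card {z. Y z = 0} < card {z. X z = 0}" "finite {z. Y z = 0}"
      by (auto intro: psubset_card_mono finite_subset)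
    from less.hyps[OF this(1) Y(1) this(2)] obtain p Z where
      pZ: "p \<noteq> 0" "Z holomorphic_on UNIV" "\<forall>z. Z z \<noteq> 0" "\<forall>z. Y z = poly p z * Z z" by blast
    show ?thesis
      using pZ Y(3) by (intro exI[of _ "[:-a, 1:] ^ n * p"] exI[of _ Z]) (auto simp: poly_power)
  qed
qed

text \<open>The truncation removes the logarithmic singularities at zeros of \<open>G\<close>, so
  circle means of ln |G| can be handled with continuous integrands only.\<close>

lemma continuous_on_ln_truncated:
  assumes "G holomorphic_on UNIV"
  shows "continuous_on UNIV (\<lambda>z. ln (max (cmod (G z)) (exp (-N))))"
proof (intro continuous_intros entire_continuous assms ballI)
  show "max (cmod (G z)) (exp (-N)) \<noteq> 0" for z
    using max.cobounded2[of "exp (-N)" "cmod (G z)"] exp_gt_zero[of "-N"] by linarith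
qed

text \<open>After the zero at the origin is divided out, scaling by e^N turns the truncated
  logarithm into N less than some \<open>logp Z\<close>, whose mean dominates its value at 0. The
  point is that \<open>C\<close> depends on neither r nor N: later N is chosen separately for each
  circle.\<close>

lemma Jensen_inequality:
  fixes X :: "complex \<Rightarrow> complex"
  assumes X: "X holomorphic_on UNIV" "X w \<noteq> 0"
  obtains C where "\<And>r N. 1 \<le> r \<Longrightarrow> - C \<le> cmean (\<lambda>z. ln (max (cmod (X z)) (exp (-N)))) 0 r"
proof -
  obtain n Y where Y: "Y holomorphic_on UNIV" "Y 0 \<noteq> 0" "\<And>z. X z = (z - 0) ^ n * Y z"
    using entire_factor_zero[OF X] by metis
  have "ln (cmod (Y 0)) \<le> cmean (\<lambda>z. ln (max (cmod (X z)) (exp (-N)))) 0 r" if r: "1 \<le> r" for r N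
  proof -
    define Z where "Z z = of_real (exp N) * Y z" for z
    have Z: "Z holomorphic_on UNIV" unfolding Z_def by (intro holomorphic_intros Y)
    have eq: "logp Z z = N + ln (max (cmod (Y z)) (exp (-N)))" for z
    proof -
      have "max 1 (cmod (Z z)) = exp N * max (exp (-N)) (cmod (Y z))"
        by (simp add: Z_def norm_mult max_mult_distrib_left exp_minus)
      moreover have "max (exp (-N)) (cmod (Y z)) \<noteq> 0"
        using max.cobounded1[of "exp (-N)" "cmod (Y z)"] exp_gt_zero[of "-N"] by linarith
      ultimately show ?thesis
        by (simp add: logp_def lnplus_eq_max ln_mult max.commute)
    qed
    have "N + ln (cmod (Y 0)) = ln (cmod (Z 0))"
      using Y(2) by (simp add: Z_def norm_mult ln_mult)
    also have "\<dots> \<le> logp Z 0" unfolding logp_def using Y(2) by (intro lnplus_ge_ln) (auto simp: Z_def)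
    also have "\<dots> \<le> nev_T Z r" using logp_le_nev_T[OF Z, of 0 r] r by simp
    also have "\<dots> \<le> cmean (\<lambda>z. N + ln (max (cmod (X z)) (exp (-N)))) 0 r"
      unfolding nev_T_eq_cmean
    proof (rule cmean_mono)
      show "continuous_on UNIV (\<lambda>z. N + ln (max (cmod (X z)) (exp (-N))))"
        by (intro continuous_intros continuous_on_ln_truncated X)
      fix z :: complex assume "cmod (z - 0) = r"
      then have "cmod (Y z) \<le> cmod (X z)"
        using r by (simp add: Y(3) norm_mult norm_power mult_le_cancel_right1 one_le_power)
      then have "max (cmod (Y z)) (exp (-N)) \<le> max (cmod (X z)) (exp (-N))" by auto
      then show "logp Z z \<le> N + ln (max (cmod (X z)) (exp (-N)))"
        by (simp add: eq less_max_iff_disj)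
    qed (use r in \<open>auto intro!: continuous_intros Z\<close>)
    also have "\<dots> = N + cmean (\<lambda>z. ln (max (cmod (X z)) (exp (-N)))) 0 r"
      by (subst cmean_add) (auto intro!: continuous_intros continuous_on_ln_truncated X simp: cmean_const)
    finally show ?thesis by simp
  qed
  then show ?thesis using that[of "- ln (cmod (Y 0))"] by auto
qed

lemma entire_bounded_on_sphere:
  fixes u :: "complex \<Rightarrow> real"
  assumes "continuous_on UNIV u"
  obtains N where "\<And>z. cmod z = r \<Longrightarrow> u z \<le> N"
proof -
  have "compact (u ` sphere 0 r)"
    by (intro compact_continuous_image continuous_on_subset[OF assms]) auto
  then have "bdd_above (u ` sphere 0 r)"
    by (simp add: compact_imp_bounded bounded_imp_bdd_above)
  then obtain N where "\<And>y. y \<in> u ` sphere 0 r \<Longrightarrow> y \<le> N" unfolding bdd_above_def by blast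
  then have "u z \<le> N" if "cmod z = r" for z using that by auto
  then show ?thesis by (rule that)
qed

text \<open>Since ln^+ (1/|G|) = ln^+ |G| - ln |G|, division by \<open>G\<close> costs the
  characteristic of \<open>G\<close> and a mean of -ln |G|, which Jensen's inequality bounds from
  above.\<close>

lemma nev_T_quotient:
  assumes E: "E holomorphic_on UNIV" and G: "G holomorphic_on UNIV" and "G w \<noteq> 0"
  obtains C where "\<And>r. 1 \<le> r \<Longrightarrow> nev_T E r \<le> nev_T (\<lambda>z. E z * G z) r + nev_T G r + C"
proof -
  obtain C where C: "\<And>r N. 1 \<le> r \<Longrightarrow> - C \<le> cmean (\<lambda>z. ln (max (cmod (G z)) (exp (-N)))) 0 r"
    using Jensen_inequality[OF G assms(3)] by blast
  have EG: "(\<lambda>z. E z * G z) holomorphic_on UNIV" by (intro holomorphic_intros E G)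
  have "nev_T E r \<le> nev_T (\<lambda>z. E z * G z) r + nev_T G r + C" if r: "1 \<le> r" for r
  proof -
    \<comment> \<open>Where |G| < e^(-N), the truncated logarithm is -N, which alone already pays
      for \<open>logp E\<close>.\<close>
    obtain N where N: "\<And>z. cmod z = r \<Longrightarrow> logp E z \<le> N"
      using entire_bounded_on_sphere[OF continuous_on_logp[OF E]] by blast
    let ?l = "\<lambda>z. ln (max (cmod (G z)) (exp (-N)))"
    have cl: "continuous_on UNIV ?l"
      by (rule continuous_on_ln_truncated[OF G])
    have "nev_T E r \<le> cmean (\<lambda>z. logp (\<lambda>z. E z * G z) z + logp G z - ?l z) 0 r"
      unfolding nev_T_eq_cmean
    proof (rule cmean_mono)
      fix z :: complex assume z: "cmod (z - 0) = r"
      show "logp E z \<le> logp (\<lambda>z. E z * G z) z + logp G z - ?l z"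
      proof (cases "exp (- N) \<le> cmod (G z)")
        case False
        then have "?l z = - N" by (simp add: max_def)
        then show ?thesis
          using N[of z] z logp_nonneg[of "\<lambda>z. E z * G z" z] logp_nonneg[of G z] unfolding diff_0_right by linarith
      next
        case True
        then have g: "0 < cmod (G z)" using exp_gt_zero[of "-N"] by linarith
        have "logp E z = lnplus (cmod (E z * G z) * (1 / cmod (G z)))"
          using g by (simp add: logp_def norm_mult)
        also have "\<dots> \<le> logp (\<lambda>z. E z * G z) z + lnplus (1 / cmod (G z))"
          unfolding logp_def by (rule lnplus_mult) auto
        also have "lnplus (1 / cmod (G z)) = logp G z - ln (cmod (G z))"
          using g by (auto simp: logp_def lnplus_def ln_div field_simps)
        finally show ?thesis using True by (simp add: max_def)
      qed
    qed (use r in \<open>auto intro!: continuous_on_diff continuous_on_add continuous_on_logp E G EG cl\<close>)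
    also have "\<dots> = nev_T (\<lambda>z. E z * G z) r + nev_T G r - cmean ?l 0 r"
      using cl by (simp add: cmean_add cmean_diff continuous_intros EG G nev_T_eq_cmean)
    finally show ?thesis using C[OF r, of N] by simp
  qed
  then show ?thesis using that by blast
qed

subsection \<open>Growth of zero-free entire functions\<close>

text \<open>max 0 u - max 0 (-u) = u, and the mean of Re h is its value at the centre.\<close>

lemma nev_T_exp_uminus:
  assumes h: "h holomorphic_on UNIV" and r: "0 \<le> r"
  shows "nev_T (\<lambda>z. exp (- h z)) r = nev_T (\<lambda>z. exp (h z)) r - Re (h 0)"
proof -
  have "cmean (logp (\<lambda>z. exp (h z))) 0 r - cmean (logp (\<lambda>z. exp (- h z))) 0 r
     = cmean (\<lambda>z. logp (\<lambda>z. exp (h z)) z - logp (\<lambda>z. exp (- h z)) z) 0 r"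
    by (subst cmean_diff) (auto intro!: continuous_intros holomorphic_intros h)
  also have "(\<lambda>z. logp (\<lambda>z. exp (h z)) z - logp (\<lambda>z. exp (- h z)) z) = (\<lambda>z. Re (h z))"
    by (auto simp: logp_exp)
  also have "cmean (\<lambda>z. Re (h z)) 0 r = Re (h 0)" by (rule cmean_Re[OF h r])
  finally show ?thesis by (simp add: nev_T_eq_cmean)
qed

text \<open>|Re h| is the sum of ln^+ |e^h| and ln^+ |e^(-h)|, so the majorants of both are
  added.\<close>

lemma harmonic_majorant_abs_Re:
  assumes h: "h holomorphic_on UNIV" and R: "R > 0" and e: "e > 0"
  obtains q where "q holomorphic_on UNIV" "\<And>z. cmod z \<le> R \<Longrightarrow> \<bar>Re (h z)\<bar> \<le> Re (q z)"
    "Re (q 0) \<le> 2 * nev_T (\<lambda>z. exp (h z)) R - Re (h 0) + e"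
proof -
  have e1: "(\<lambda>z. exp (h z)) holomorphic_on UNIV" and e2: "(\<lambda>z. exp (- h z)) holomorphic_on UNIV"
    by (intro holomorphic_intros h)+
  obtain q1 where q1: "q1 holomorphic_on UNIV" "\<And>z. cmod z \<le> R \<Longrightarrow> logp (\<lambda>z. exp (h z)) z \<le> Re (q1 z)"
    "Re (q1 0) \<le> nev_T (\<lambda>z. exp (h z)) R + e / 2" using harmonic_majorant[OF e1 R, of "e/2"] e by auto
  obtain q2 where q2: "q2 holomorphic_on UNIV" "\<And>z. cmod z \<le> R \<Longrightarrow> logp (\<lambda>z. exp (- h z)) z \<le> Re (q2 z)"
    "Re (q2 0) \<le> nev_T (\<lambda>z. exp (- h z)) R + e / 2" using harmonic_majorant[OF e2 R, of "e/2"] e by auto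
  show ?thesis
  proof (rule that[of "\<lambda>z. q1 z + q2 z"])
    show "(\<lambda>z. q1 z + q2 z) holomorphic_on UNIV" by (intro holomorphic_intros q1 q2)
    show "\<bar>Re (h z)\<bar> \<le> Re (q1 z + q2 z)" if "cmod z \<le> R" for z
      using q1(2)[OF that] q2(2)[OF that] by (simp add: logp_exp abs_le_iff)
    show "Re (q1 0 + q2 0) \<le> 2 * nev_T (\<lambda>z. exp (h z)) R - Re (h 0) + e"
      using q1(3) q2(3) nev_T_exp_uminus[OF h, of R] R by simp
  qed
qed

lemma deriv_le_majorant:
  assumes h: "h holomorphic_on UNIV" and q: "q holomorphic_on UNIV"
    and maj: "\<And>z. cmod z \<le> R \<Longrightarrow> \<bar>Re (h z)\<bar> \<le> Re (q z)"
    and s: "s > 0" "cmod z + s \<le> R"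
  shows "cmod (deriv h z) \<le> 2 / s * Re (q z)"
proof -
  have "cmod (deriv h z) \<le> 2 / s * cmean (\<lambda>z. \<bar>Re (h z)\<bar>) z s" by (rule gradient_bound[OF h s(1)])
  also have "\<dots> \<le> 2 / s * cmean (\<lambda>z. Re (q z)) z s"
  proof (intro mult_left_mono cmean_mono)
    fix w assume "cmod (w - z) = s"
    then show "\<bar>Re (h w)\<bar> \<le> Re (q w)"
      using maj[of w] norm_triangle_ineq[of z "w - z"] s by auto
  qed (use s in \<open>auto intro!: continuous_intros entire_continuous h q\<close>)
  also have "\<dots> = 2 / s * Re (q z)" using cmean_Re[OF q, of s z] s by simp
  finally show ?thesis .
qed

lemma nev_T_le_of_majorant:
  assumes g: "g holomorphic_on UNIV" and q: "q holomorphic_on UNIV" and r: "0 \<le> r"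
    and le: "\<And>z. cmod z = r \<Longrightarrow> logp g z \<le> k * Re (q z)"
  shows "nev_T g r \<le> k * Re (q 0)"
proof -
  have "nev_T g r \<le> cmean (\<lambda>z. k * Re (q z)) 0 r"
    unfolding nev_T_eq_cmean
    by (rule cmean_mono) (use le r in \<open>auto intro!: continuous_intros entire_continuous g q\<close>)
  then show ?thesis using cmean_Re[OF q r] by (simp add: cmean_cmult)
qed

text \<open>Here h' is the logarithmic derivative of e^h. Even the crude ln^+ x <= x suffices,
  because the factor 1/s can be made as small as wished.\<close>

lemma nev_T_deriv_exponent:
  assumes h: "h holomorphic_on UNIV" and r: "0 \<le> r" and s: "s > 0"
  shows "nev_T (deriv h) r \<le> 2 / s * (2 * nev_T (\<lambda>z. exp (h z)) (r + s) - Re (h 0))"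
proof (rule field_le_epsilon)
  fix e :: real assume e: "e > 0"
  obtain q where q: "q holomorphic_on UNIV" "\<And>z. cmod z \<le> r + s \<Longrightarrow> \<bar>Re (h z)\<bar> \<le> Re (q z)"
    "Re (q 0) \<le> 2 * nev_T (\<lambda>z. exp (h z)) (r + s) - Re (h 0) + e * s / 2"
    using harmonic_majorant_abs_Re[OF h, of "r + s" "e * s / 2"] e r s by auto
  have "nev_T (deriv h) r \<le> 2 / s * Re (q 0)"
  proof (rule nev_T_le_of_majorant[OF _ q(1) r])
    show "deriv h holomorphic_on UNIV" using h by (intro holomorphic_intros) auto
    fix z :: complex assume "cmod z = r"
    then have "cmod (deriv h z) \<le> 2 / s * Re (q z)"
      by (intro deriv_le_majorant[OF h q(1,2)] s) auto
    then show "logp (deriv h) z \<le> 2 / s * Re (q z)"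
      using lnplus_le_self[of "cmod (deriv h z)"] by (simp add: logp_def)
  qed
  also have "\<dots> \<le> 2 / s * (2 * nev_T (\<lambda>z. exp (h z)) (r + s) - Re (h 0) + e * s / 2)"
    using q(3) s by (intro mult_left_mono) auto
  also have "\<dots> = 2 / s * (2 * nev_T (\<lambda>z. exp (h z)) (r + s) - Re (h 0)) + e"
    using s by (simp add: field_simps)
  finally show "nev_T (deriv h) r \<le> 2 / s * (2 * nev_T (\<lambda>z. exp (h z)) (r + s) - Re (h 0)) + e" .
qed

text \<open>The segment from z to z + 1 stays in the unit disc about z, where |h'| is at most 2/s
  times three times the majorant at z; hence the 6.\<close>

lemma nev_T_exp_difference:
  assumes h: "h holomorphic_on UNIV" and r: "0 \<le> r" and s: "s > 0"
  shows "nev_T (\<lambda>z. exp (h (z + 1) - h z)) r \<le> 6 / s * (2 * nev_T (\<lambda>z. exp (h z)) (r + s + 2) - Re (h 0))"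
proof (rule field_le_epsilon)
  fix e :: real assume e: "e > 0"
  obtain q where q: "q holomorphic_on UNIV" "\<And>z. cmod z \<le> r + s + 2 \<Longrightarrow> \<bar>Re (h z)\<bar> \<le> Re (q z)"
    "Re (q 0) \<le> 2 * nev_T (\<lambda>z. exp (h z)) (r + s + 2) - Re (h 0) + e * s / 6"
    using harmonic_majorant_abs_Re[OF h, of "r + s + 2" "e * s / 6"] e r s by auto
  have q0: "0 \<le> Re (q z)" if "cmod z \<le> r + s + 2" for z using q(2)[OF that] by linarith
  have hs: "(\<lambda>z. h (z + 1)) holomorphic_on UNIV"
    by (intro holomorphic_on_compose[OF _ holomorphic_on_subset[OF h], unfolded o_def] holomorphic_intros) auto
  have "nev_T (\<lambda>z. exp (h (z + 1) - h z)) r \<le> 6 / s * Re (q 0)"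
  proof (rule nev_T_le_of_majorant[OF _ q(1) r])
    show "(\<lambda>z. exp (h (z + 1) - h z)) holomorphic_on UNIV" by (intro holomorphic_intros hs h)
    fix z :: complex assume z: "cmod z = r"
    have "cmod (h (z + 1) - h z) \<le> 6 / s * Re (q z) * cmod (z + 1 - z)"
    proof (rule field_differentiable_bound[of "cball z 1" h "deriv h"])
      show "(h has_field_derivative deriv h w) (at w within cball z 1)" for w
        using h by (auto intro: has_field_derivative_at_within holomorphic_derivI)
      fix w assume "w \<in> cball z 1"
      then have w: "cmod (w - z) \<le> 1" by (simp add: dist_norm norm_minus_commute)
      have "cmod w \<le> r + 1" using norm_triangle_ineq[of z "w - z"] z w by auto
      then have "cmod (deriv h w) \<le> 2 / s * Re (q w)"
        using s by (intro deriv_le_majorant[OF h q(1,2)]) auto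
      also have "Re (q w) \<le> 3 * Re (q z)"
        by (rule Harnack_unit_disc[OF q(1) q0]) (use z w s in auto)
      finally show "cmod (deriv h w) \<le> 6 / s * Re (q z)" using s by (simp add: field_simps)
    qed (auto simp: dist_norm)
    moreover have "0 \<le> 6 / s * Re (q z)" using q0[of z] z s by simp
    ultimately show "logp (\<lambda>z. exp (h (z + 1) - h z)) z \<le> 6 / s * Re (q z)"
      using complex_Re_le_cmod[of "h (z + 1) - h z"] unfolding logp_exp by simp
  qed
  also have "\<dots> \<le> 6 / s * (2 * nev_T (\<lambda>z. exp (h z)) (r + s + 2) - Re (h 0) + e * s / 6)"
    using q(3) s by (intro mult_left_mono) auto
  also have "\<dots> = 6 / s * (2 * nev_T (\<lambda>z. exp (h z)) (r + s + 2) - Re (h 0)) + e"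
    using s by (simp add: field_simps)
  finally show "nev_T (\<lambda>z. exp (h (z + 1) - h z)) r \<le> 6 / s * (2 * nev_T (\<lambda>z. exp (h z)) (r + s + 2) - Re (h 0)) + e" .
qed

text \<open>12 = 4 * 3: the gradient bound on a circle of radius R/2, and Harnack's factor for |z|
  <= R/2. Read at a fixed z, it bounds the characteristic from below.\<close>

lemma deriv_exponent_le:
  assumes h: "h holomorphic_on UNIV" and R: "R > 0" and z: "cmod z \<le> R / 2"
  shows "cmod (deriv h z) \<le> 12 / R * (2 * nev_T (\<lambda>z. exp (h z)) R - Re (h 0))"
proof (rule field_le_epsilon)
  fix e :: real assume e: "e > 0"
  obtain q where q: "q holomorphic_on UNIV" "\<And>z. cmod z \<le> R \<Longrightarrow> \<bar>Re (h z)\<bar> \<le> Re (q z)"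
    "Re (q 0) \<le> 2 * nev_T (\<lambda>z. exp (h z)) R - Re (h 0) + e * R / 12"
    using harmonic_majorant_abs_Re[OF h, of R "e * R / 12"] e R by auto
  have q0: "0 \<le> Re (q z)" if "cmod z \<le> R" for z using q(2)[OF that] by linarith
  have "cmod (deriv h z) \<le> 2 / (R / 2) * Re (q z)"
    by (rule deriv_le_majorant[OF h q(1,2)]) (use z R in auto)
  also have "Re (q z) \<le> (R + cmod z) / (R - cmod z) * Re (q 0)"
    by (rule Harnack[OF q(1)]) (use z R q0 in auto)
  also have "\<dots> \<le> 3 * Re (q 0)"
    using z R q0[of 0] by (intro mult_right_mono) (auto simp: field_simps)
  also have "Re (q 0) \<le> 2 * nev_T (\<lambda>z. exp (h z)) R - Re (h 0) + e * R / 12" by (rule q(3))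
  finally have "cmod (deriv h z) \<le> 2 / (R / 2) * (3 * (2 * nev_T (\<lambda>z. exp (h z)) R - Re (h 0) + e * R / 12))"
    using R by (simp add: divide_right_mono mult_left_mono)
  also have "\<dots> = 12 / R * (2 * nev_T (\<lambda>z. exp (h z)) R - Re (h 0)) + e"
    using R by (simp add: field_simps)
  finally show "cmod (deriv h z) \<le> 12 / R * (2 * nev_T (\<lambda>z. exp (h z)) R - Re (h 0)) + e" .
qed

lemma nev_T_exp_linear_growth:
  assumes h: "h holomorphic_on UNIV" and z: "deriv h z \<noteq> 0"
  obtains c where "c > 0" "eventually (\<lambda>R. c * R \<le> nev_T (\<lambda>z. exp (h z)) R) at_top"
proof
  \<comment> \<open>Half of the 48 absorbs \<open>Re (h 0)\<close> for large R; the other half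
    matches the 24 in front of the characteristic.\<close>
  define c where "c = cmod (deriv h z) / 48"
  show c: "c > 0" using z by (simp add: c_def)
  have "eventually (\<lambda>R. R > (0::real)) at_top" "eventually (\<lambda>R. 2 * cmod z \<le> R) at_top"
    "eventually (\<lambda>R. \<bar>Re (h 0)\<bar> / (2 * c) \<le> R) at_top"
    by (simp_all add: eventually_gt_at_top eventually_ge_at_top)
  then show "eventually (\<lambda>R. c * R \<le> nev_T (\<lambda>z. exp (h z)) R) at_top"
  proof eventually_elim
    case (elim R)
    have "48 * c \<le> 12 / R * (2 * nev_T (\<lambda>z. exp (h z)) R - Re (h 0))"
      using deriv_exponent_le[OF h, of R z] elim by (simp add: c_def)
    then have "48 * (c * R) \<le> 12 * (2 * nev_T (\<lambda>z. exp (h z)) R - Re (h 0))"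
      using elim by (simp add: field_simps)
    moreover have "- Re (h 0) \<le> 2 * (c * R)" using elim c by (simp add: field_simps)
    ultimately show ?case by simp
  qed
qed

lemma exponent_constant:
  assumes h: "h holomorphic_on UNIV"
    and small: "\<And>\<delta>. \<delta> > 0 \<Longrightarrow> eventually (\<lambda>r. nev_T (\<lambda>z. exp (h z)) r \<le> \<delta> * r) at_top"
  obtains c where "\<And>z. h z = c"
proof -
  have "deriv h z = 0" for z
  proof (rule ccontr)
    assume "deriv h z \<noteq> 0"
    then obtain c where c: "c > 0" "eventually (\<lambda>R. c * R \<le> nev_T (\<lambda>z. exp (h z)) R) at_top"
      using nev_T_exp_linear_growth[OF h] by blast
    have "eventually (\<lambda>R. R > (0::real) \<and> c * R \<le> c / 2 * R) at_top"
      using c(2) small[OF half_gt_zero[OF c(1)]] eventually_gt_at_top[of 0] by eventually_elim linarith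
    then obtain R where "R > (0::real)" "c * R \<le> c / 2 * R"
      using eventually_happens' trivial_limit_at_top_linorder by blast
    with c show False by simp
  qed
  moreover have "(h has_field_derivative deriv h z) (at z)" for z
    using h by (auto intro: holomorphic_derivI)
  ultimately have "\<exists>c. \<forall>x\<in>UNIV. h x = c"
    by (intro has_field_derivative_zero_constant) auto
  then show ?thesis using that by blast
qed

lemma nev_T_poly:
  obtains C where "C \<ge> 0" "\<And>r. 1 \<le> r \<Longrightarrow> nev_T (poly p) r \<le> C * (1 + ln r)"
proof -
  have "\<exists>C\<ge>0. \<forall>r\<ge>1. nev_T (poly p) r \<le> C * (1 + ln r)"
  proof (induction p)
    case 0
    then show ?case by (intro exI[of _ 0]) (simp add: nev_T_def lnplus_def)
  next
    case (pCons a p)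
    then obtain C where C: "C \<ge> 0" "\<And>r. r \<ge> 1 \<Longrightarrow> nev_T (poly p) r \<le> C * (1 + ln r)" by auto
    define D where "D = lnplus (cmod a) + C + ln 2 + 1"
    have "nev_T (poly (pCons a p)) r \<le> D * (1 + ln r)" if r: "r \<ge> 1" for r
    proof -
      have "nev_T (poly (pCons a p)) r = nev_T (\<lambda>z. a + z * poly p z) r"
        by (rule arg_cong[where f = "\<lambda>g. nev_T g r"]) auto
      also have "\<dots> \<le> nev_T (\<lambda>z. a) r + nev_T (\<lambda>z. z * poly p z) r + ln 2"
        using r by (intro nev_T_add holomorphic_intros) auto
      also have "nev_T (\<lambda>z. z * poly p z) r \<le> nev_T (\<lambda>z. z) r + nev_T (poly p) r"
        using r by (intro nev_T_mult holomorphic_intros) auto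
      also have "\<dots> \<le> ln r + C * (1 + ln r)"
        using r C(2)[OF r] by (simp add: nev_T_ident lnplus_eq_max)
      also have "nev_T (\<lambda>z. a) r + (ln r + C * (1 + ln r)) + ln 2 \<le> D * (1 + ln r)"
      proof -
        have "0 \<le> (lnplus (cmod a) + ln 2) * ln r" using r by (intro mult_nonneg_nonneg add_nonneg_nonneg) auto
        then show ?thesis by (simp add: D_def nev_T_const algebra_simps)
      qed
      finally show ?thesis by simp
    qed
    moreover have "D \<ge> 0" using C by (simp add: D_def)
    ultimately show ?case by blast
  qed
  then show ?thesis using that by blast
qed

subsection \<open>Functions that are small compared with an exponential\<close>

text \<open>If T more than doubled over every step of length n, it would exceed 2^k after k steps,
  an exponential rate of ln 2 / n. The growth hypothesis at half that rate, \<open>\<delta>\<close>,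
  contradicts this. Linear growth supplies a starting radius with T at least 1.\<close>

lemma doubling_radii:
  assumes h: "h holomorphic_on UNIV" and z: "deriv h z \<noteq> 0"
    and growth: "\<And>\<delta>. \<delta> > 0 \<Longrightarrow> eventually (\<lambda>r. nev_T (\<lambda>z. exp (h z)) r \<le> exp (\<delta> * r)) at_top"
  obtains \<rho> :: "nat \<Rightarrow> real" where "\<And>n. real n + 1 \<le> \<rho> n"
    "\<And>n. nev_T (\<lambda>z. exp (h z)) (\<rho> n + real n) \<le> 2 * nev_T (\<lambda>z. exp (h z)) (\<rho> n)"
proof -
  let ?T = "nev_T (\<lambda>z. exp (h z))"
  obtain c where c: "c > 0" "eventually (\<lambda>R. c * R \<le> ?T R) at_top"
    using nev_T_exp_linear_growth[OF h z] by blast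
  have "\<exists>r. real n + 1 \<le> r \<and> ?T (r + real n) \<le> 2 * ?T r" for n :: nat
  proof (rule ccontr)
    assume neg: "\<not> ?thesis"
    then have dbl: "2 * ?T r \<le> ?T (r + real n)" if "real n + 1 \<le> r" for r using that by force
    have n: "n \<ge> 1"
    proof (rule ccontr)
      assume "\<not> n \<ge> 1"
      then have "n = 0" by simp
      then have "?T (1 + real n) \<le> 2 * ?T 1" "real n + 1 \<le> 1" by simp_all
      with neg show False by blast
    qed
    have "eventually (\<lambda>r. c * r \<le> ?T r \<and> real n + 1 \<le> r \<and> 1 / c \<le> r) at_top"
      using c(2) eventually_ge_at_top[of "real n + 1"] eventually_ge_at_top[of "1 / c"]
      by eventually_elim auto
    then obtain r0 where r0: "c * r0 \<le> ?T r0" "real n + 1 \<le> r0" "1 / c \<le> r0"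
      using eventually_happens' trivial_limit_at_top_linorder by blast
    then have T1: "1 \<le> ?T r0" using c by (simp add: field_simps)
    have pow: "2 ^ k \<le> ?T (r0 + real k * real n)" for k :: nat
    proof (induction k)
      case 0
      show ?case using T1 by simp
    next
      case (Suc k)
      have "2 * 2 ^ k \<le> 2 * ?T (r0 + real k * real n)" using Suc by simp
      also have "\<dots> \<le> ?T (r0 + real k * real n + real n)" using r0 by (intro dbl) (simp add: add_increasing2)
      finally show ?case by (simp add: algebra_simps)
    qed
    define \<delta> where "\<delta> = ln 2 / (2 * real n)"
    have d: "\<delta> > 0" using n by (simp add: \<delta>_def)
    then obtain R where R: "\<And>r. r \<ge> R \<Longrightarrow> ?T r \<le> exp (\<delta> * r)"
      using growth[OF d] unfolding eventually_at_top_linorder by blast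
    obtain k :: nat where k: "real k > max R (2 * \<delta> * r0 / ln 2)" using reals_Archimedean2 by blast
    have "real k * 1 \<le> real k * real n" using n by (intro mult_left_mono) auto
    then have "R \<le> r0 + real k * real n" using k r0 n by auto
    then have "2 ^ k \<le> exp (\<delta> * (r0 + real k * real n))" using pow[of k] R[of "r0 + real k * real n"] by linarith
    then have "ln (2 ^ k) \<le> ln (exp (\<delta> * (r0 + real k * real n)))" by (intro ln_mono) auto
    then have "real k * ln 2 \<le> \<delta> * r0 + real k * ln 2 / 2"
      using n by (simp add: \<delta>_def ln_realpow field_simps)
    moreover have "2 * \<delta> * r0 < real k * ln 2" using k by (simp add: field_simps)
    ultimately show False by simp
  qed
  then obtain \<rho> where "\<And>n. real n + 1 \<le> \<rho> n \<and> ?T (\<rho> n + real n) \<le> 2 * ?T (\<rho> n)" by metis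
  then show ?thesis using that by blast
qed

locale doubling_exponential =
  fixes h :: "complex \<Rightarrow> complex" and \<rho> :: "nat \<Rightarrow> real" and z0 :: complex
  assumes h: "h holomorphic_on UNIV" and nonconst: "deriv h z0 \<noteq> 0"
    and radii: "real n + 1 \<le> \<rho> n"
    and doubling: "nev_T (\<lambda>z. exp (h z)) (\<rho> n + real n) \<le> 2 * nev_T (\<lambda>z. exp (h z)) (\<rho> n)"
begin

abbreviation w :: "complex \<Rightarrow> complex" where "w \<equiv> \<lambda>z. exp (h z)"
abbreviation T :: "real \<Rightarrow> real" where "T \<equiv> nev_T w"

text \<open>Demanding the bound for every K makes the class closed under derivatives and shifts,
  whose estimates use a larger radius.\<close>

definition small :: "(complex \<Rightarrow> complex) \<Rightarrow> bool" where
  "small g \<longleftrightarrow> g holomorphic_on UNIV \<and>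
     (\<forall>K\<ge>0. \<forall>\<epsilon>>0. eventually (\<lambda>n. nev_T g (\<rho> n + K) \<le> \<epsilon> * T (\<rho> n)) sequentially)"

text \<open>One M serves all K: in \<open>exponent_estimate\<close> the enlargement s of the radius
  is chosen only after M is known.\<close>

definition comparable :: "(complex \<Rightarrow> complex) \<Rightarrow> bool" where
  "comparable g \<longleftrightarrow> g holomorphic_on UNIV \<and>
     (\<exists>M. \<forall>K\<ge>0. eventually (\<lambda>n. nev_T g (\<rho> n + K) \<le> M * T (\<rho> n)) sequentially)"

lemma w_holomorphic: "w holomorphic_on UNIV"
  by (intro holomorphic_intros h)

lemma small_holomorphic: "small g \<Longrightarrow> g holomorphic_on UNIV"
  by (simp add: small_def)

lemma smallD: "small g \<Longrightarrow> K \<ge> 0 \<Longrightarrow> \<epsilon> > 0 \<Longrightarrow> eventually (\<lambda>n. nev_T g (\<rho> n + K) \<le> \<epsilon> * T (\<rho> n)) sequentially"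
  by (simp add: small_def)

lemma radius_at_top: "filterlim \<rho> at_top sequentially"
  by (rule filterlim_at_top_mono[OF filterlim_real_sequentially])
     (auto intro!: always_eventually order_trans[OF _ radii])

lemma radius_pos: "\<rho> n > 0"
  using radii[of n] of_nat_0_le_iff[of n, where 'a = real] by linarith

lemma linear_lower_bound:
  obtains c where "c > 0" "eventually (\<lambda>n. c * \<rho> n \<le> T (\<rho> n)) sequentially"
proof -
  obtain c where c: "c > 0" "eventually (\<lambda>R. c * R \<le> T R) at_top"
    using nev_T_exp_linear_growth[OF h nonconst] by blast
  show ?thesis using that[OF c(1) eventually_compose_filterlim[OF c(2) radius_at_top]] .
qed

text \<open>T grows at least linearly because h' is not identically zero; this absorbs constants and
  logarithms of the radius.\<close>

lemma eventually_dominated: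
  assumes "((\<lambda>r. u r / r) \<longlongrightarrow> 0) at_top" and e: "\<epsilon> > 0"
  shows "eventually (\<lambda>n. u (\<rho> n) \<le> \<epsilon> * T (\<rho> n)) sequentially"
proof -
  obtain c where c: "c > 0" "eventually (\<lambda>n. c * \<rho> n \<le> T (\<rho> n)) sequentially"
    using linear_lower_bound by blast
  have "eventually (\<lambda>r. u r / r < \<epsilon> * c) at_top"
    using c e by (intro order_tendstoD(2)[OF assms(1)]) auto
  then have "eventually (\<lambda>n. u (\<rho> n) / \<rho> n < \<epsilon> * c) sequentially"
    by (rule eventually_compose_filterlim[OF _ radius_at_top])
  then show ?thesis using c(2)
  proof eventually_elim
    case (elim n)
    have "u (\<rho> n) \<le> \<epsilon> * (c * \<rho> n)" using elim radius_pos[of n] by (simp add: field_simps)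
    also have "\<dots> \<le> \<epsilon> * T (\<rho> n)" using elim e by (intro mult_left_mono) auto
    finally show ?case .
  qed
qed

lemma eventually_const_dominated: "\<epsilon> > 0 \<Longrightarrow> eventually (\<lambda>n. C \<le> \<epsilon> * T (\<rho> n)) sequentially"
  by (rule eventually_dominated[of "\<lambda>_. C"], real_asymp, assumption)

section \<open>Closure properties of small functions\<close>

lemma small_add:
  assumes "small f" "small g"
  shows "small (\<lambda>z. f z + g z)"
  unfolding small_def
proof (intro conjI allI impI)
  show "(\<lambda>z. f z + g z) holomorphic_on UNIV" by (intro holomorphic_intros small_holomorphic assms)
  fix K \<epsilon> :: real assume K: "K \<ge> 0" and e: "\<epsilon> > 0"
  have e3: "\<epsilon> / 3 > 0" using e by simp
  show "eventually (\<lambda>n. nev_T (\<lambda>z. f z + g z) (\<rho> n + K) \<le> \<epsilon> * T (\<rho> n)) sequentially"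
    using smallD[OF assms(1) K e3] smallD[OF assms(2) K e3] eventually_const_dominated[OF e3, of "ln 2"]
  proof eventually_elim
    case (elim n)
    have "nev_T (\<lambda>z. f z + g z) (\<rho> n + K) \<le> nev_T f (\<rho> n + K) + nev_T g (\<rho> n + K) + ln 2"
      using radius_pos[of n] K by (intro nev_T_add small_holomorphic assms) auto
    then show ?case using elim by simp
  qed
qed

lemma small_mult:
  assumes "small f" "small g"
  shows "small (\<lambda>z. f z * g z)"
  unfolding small_def
proof (intro conjI allI impI)
  show "(\<lambda>z. f z * g z) holomorphic_on UNIV" by (intro holomorphic_intros small_holomorphic assms)
  fix K \<epsilon> :: real assume K: "K \<ge> 0" and e: "\<epsilon> > 0"
  have e2: "\<epsilon> / 2 > 0" using e by simp
  show "eventually (\<lambda>n. nev_T (\<lambda>z. f z * g z) (\<rho> n + K) \<le> \<epsilon> * T (\<rho> n)) sequentially"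
    using smallD[OF assms(1) K e2] smallD[OF assms(2) K e2]
  proof eventually_elim
    case (elim n)
    have "nev_T (\<lambda>z. f z * g z) (\<rho> n + K) \<le> nev_T f (\<rho> n + K) + nev_T g (\<rho> n + K)"
      using radius_pos[of n] K by (intro nev_T_mult small_holomorphic assms) auto
    then show ?case using elim by simp
  qed
qed

lemma small_minus: "small f \<Longrightarrow> small (\<lambda>z. - f z)"
  by (auto simp: small_def nev_T_minus intro!: holomorphic_intros)

lemma small_diff: "small f \<Longrightarrow> small g \<Longrightarrow> small (\<lambda>z. f z - g z)"
  using small_add[OF _ small_minus, of f g] by simp

lemma small_poly: "small (poly p)"
  unfolding small_def
proof (intro conjI allI impI)
  show "poly p holomorphic_on UNIV" by (intro holomorphic_intros)
  fix K \<epsilon> :: real assume K: "K \<ge> 0" and e: "\<epsilon> > 0"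
  obtain C where C: "C \<ge> 0" "\<And>r. 1 \<le> r \<Longrightarrow> nev_T (poly p) r \<le> C * (1 + ln r)" using nev_T_poly by blast
  have "eventually (\<lambda>n. C * (1 + ln (\<rho> n + K)) \<le> \<epsilon> * T (\<rho> n)) sequentially"
  proof (rule eventually_dominated[OF _ e])
    show "((\<lambda>r. C * (1 + ln (r + K)) / r) \<longlongrightarrow> 0) at_top" by real_asymp
  qed
  then show "eventually (\<lambda>n. nev_T (poly p) (\<rho> n + K) \<le> \<epsilon> * T (\<rho> n)) sequentially"
  proof eventually_elim
    case (elim n)
    have "1 \<le> \<rho> n + K" using K radii[of n] by simp
    from C(2)[OF this] elim show ?case by simp
  qed
qed

lemma small_const: "small (\<lambda>z. c)"
proof -
  have "(\<lambda>z. c) = poly [:c:]" by auto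
  then show ?thesis using small_poly by metis
qed

lemma small_deriv:
  assumes "small g"
  shows "small (deriv g)"
  unfolding small_def
proof (intro conjI allI impI)
  show "deriv g holomorphic_on UNIV" using small_holomorphic[OF assms] by (intro holomorphic_intros) auto
  fix K \<epsilon> :: real assume K: "K \<ge> 0" and e: "\<epsilon> > 0"
  have "eventually (\<lambda>n. nev_T g (\<rho> n + (K + 2)) \<le> \<epsilon> / 3 * T (\<rho> n)) sequentially"
    using K e by (intro smallD assms) auto
  then show "eventually (\<lambda>n. nev_T (deriv g) (\<rho> n + K) \<le> \<epsilon> * T (\<rho> n)) sequentially"
  proof eventually_elim
    case (elim n)
    have "nev_T (deriv g) (\<rho> n + K) \<le> 3 * nev_T g (\<rho> n + K + 2)"
      using K radius_pos[of n] by (intro nev_T_deriv small_holomorphic assms) auto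
    then show ?case using elim by (simp add: add.assoc)
  qed
qed

lemma small_shift:
  assumes "small g"
  shows "small (\<lambda>z. g (z + 1))"
  unfolding small_def
proof (intro conjI allI impI)
  show "(\<lambda>z. g (z + 1)) holomorphic_on UNIV"
    by (intro holomorphic_on_compose[OF _ holomorphic_on_subset[OF small_holomorphic[OF assms]], unfolded o_def] holomorphic_intros) auto
  fix K \<epsilon> :: real assume K: "K \<ge> 0" and e: "\<epsilon> > 0"
  have "eventually (\<lambda>n. nev_T g (\<rho> n + (K + 1)) \<le> \<epsilon> / 2 * T (\<rho> n)) sequentially"
    using K e by (intro smallD assms) auto
  then show "eventually (\<lambda>n. nev_T (\<lambda>z. g (z + 1)) (\<rho> n + K) \<le> \<epsilon> * T (\<rho> n)) sequentially"
    using eventually_ge_at_top[of 1]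
  proof eventually_elim
    case (elim n)
    have "nev_T (\<lambda>z. g (z + 1)) (\<rho> n + K) \<le> 2 * nev_T g (\<rho> n + K + 1)"
      using K radii[of n] elim(2) by (intro nev_T_shift small_holomorphic assms) auto
    then show ?case using elim(1) by (simp add: add.assoc)
  qed
qed

section \<open>Functions growing at most like a multiple of T\<close>

lemma comparable_holomorphic: "comparable g \<Longrightarrow> g holomorphic_on UNIV"
  by (simp add: comparable_def)

lemma small_imp_comparable: "small g \<Longrightarrow> comparable g"
  unfolding comparable_def by (intro conjI exI[of _ 1] allI impI smallD small_holomorphic) auto

lemma comparable_w: "comparable w"
  unfolding comparable_def
proof (intro conjI exI allI impI)
  show "w holomorphic_on UNIV" by (rule w_holomorphic)
  fix K :: real assume K: "K \<ge> 0"
  obtain m :: nat where m: "K \<le> real m" using real_arch_simple by blast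
  show "eventually (\<lambda>n. T (\<rho> n + K) \<le> 2 * T (\<rho> n)) sequentially"
    using eventually_ge_at_top[of m]
  proof eventually_elim
    case (elim n)
    have "T (\<rho> n + K) \<le> T (\<rho> n + real n)"
      using m elim K radius_pos[of n] by (intro nev_T_mono w_holomorphic) auto
    then show ?case using doubling[of n] by linarith
  qed
qed

lemma comparable_add:
  assumes "comparable f" "comparable g"
  shows "comparable (\<lambda>z. f z + g z)"
proof -
  obtain M N where
    M: "\<And>K. K \<ge> 0 \<Longrightarrow> eventually (\<lambda>n. nev_T f (\<rho> n + K) \<le> M * T (\<rho> n)) sequentially" and
    N: "\<And>K. K \<ge> 0 \<Longrightarrow> eventually (\<lambda>n. nev_T g (\<rho> n + K) \<le> N * T (\<rho> n)) sequentially"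
    using assms unfolding comparable_def by blast
  have "eventually (\<lambda>n. nev_T (\<lambda>z. f z + g z) (\<rho> n + K) \<le> (M + N + 1) * T (\<rho> n)) sequentially" if K: "K \<ge> 0" for K
    using M[OF K] N[OF K] eventually_const_dominated[OF zero_less_one, of "ln 2"]
  proof eventually_elim
    case (elim n)
    have "nev_T (\<lambda>z. f z + g z) (\<rho> n + K) \<le> nev_T f (\<rho> n + K) + nev_T g (\<rho> n + K) + ln 2"
      using radius_pos[of n] K by (intro nev_T_add comparable_holomorphic assms) auto
    then show ?case using elim by (simp add: algebra_simps)
  qed
  moreover have "(\<lambda>z. f z + g z) holomorphic_on UNIV" by (intro holomorphic_intros comparable_holomorphic assms)
  ultimately show ?thesis unfolding comparable_def by blast
qed

lemma comparable_mult:
  assumes "comparable f" "comparable g"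
  shows "comparable (\<lambda>z. f z * g z)"
proof -
  obtain M N where
    M: "\<And>K. K \<ge> 0 \<Longrightarrow> eventually (\<lambda>n. nev_T f (\<rho> n + K) \<le> M * T (\<rho> n)) sequentially" and
    N: "\<And>K. K \<ge> 0 \<Longrightarrow> eventually (\<lambda>n. nev_T g (\<rho> n + K) \<le> N * T (\<rho> n)) sequentially"
    using assms unfolding comparable_def by blast
  have "eventually (\<lambda>n. nev_T (\<lambda>z. f z * g z) (\<rho> n + K) \<le> (M + N) * T (\<rho> n)) sequentially" if K: "K \<ge> 0" for K
    using M[OF K] N[OF K]
  proof eventually_elim
    case (elim n)
    have "nev_T (\<lambda>z. f z * g z) (\<rho> n + K) \<le> nev_T f (\<rho> n + K) + nev_T g (\<rho> n + K)"
      using radius_pos[of n] K by (intro nev_T_mult comparable_holomorphic assms) auto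
    then show ?case using elim by (simp add: algebra_simps)
  qed
  moreover have "(\<lambda>z. f z * g z) holomorphic_on UNIV" by (intro holomorphic_intros comparable_holomorphic assms)
  ultimately show ?thesis unfolding comparable_def by blast
qed

lemma comparable_quotient:
  assumes E: "E holomorphic_on UNIV" and EG: "comparable (\<lambda>z. E z * G z)" and G: "comparable G" "G x \<noteq> 0"
  shows "comparable E"
proof -
  obtain C where C: "\<And>r. 1 \<le> r \<Longrightarrow> nev_T E r \<le> nev_T (\<lambda>z. E z * G z) r + nev_T G r + C"
    using nev_T_quotient[OF E comparable_holomorphic[OF G(1)] G(2)] by blast
  obtain M N where
    M: "\<And>K. K \<ge> 0 \<Longrightarrow> eventually (\<lambda>n. nev_T (\<lambda>z. E z * G z) (\<rho> n + K) \<le> M * T (\<rho> n)) sequentially" and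
    N: "\<And>K. K \<ge> 0 \<Longrightarrow> eventually (\<lambda>n. nev_T G (\<rho> n + K) \<le> N * T (\<rho> n)) sequentially"
    using EG G unfolding comparable_def by blast
  have "eventually (\<lambda>n. nev_T E (\<rho> n + K) \<le> (M + N + 1) * T (\<rho> n)) sequentially" if K: "K \<ge> 0" for K
    using M[OF K] N[OF K] eventually_const_dominated[OF zero_less_one, of C]
  proof eventually_elim
    case (elim n)
    have "1 \<le> \<rho> n + K" using K radii[of n] by simp
    from C[OF this] elim show ?case by (simp add: algebra_simps)
  qed
  with E show ?thesis unfolding comparable_def by blast
qed

lemma exponent_estimate:
  assumes Q: "Q holomorphic_on UNIV" and cQ: "comparable (\<lambda>z. exp (Q z))"
    and F: "F holomorphic_on UNIV" and "k \<ge> 0"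
    and le: "\<And>r s. 0 \<le> r \<Longrightarrow> 0 < s \<Longrightarrow> nev_T F r \<le> k / s * (2 * nev_T (\<lambda>z. exp (Q z)) (r + s + 2) - Re (Q 0))"
  shows "small F"
  unfolding small_def
proof (intro conjI allI impI F)
  fix K \<epsilon> :: real assume K: "K \<ge> 0" and e: "\<epsilon> > 0"
  obtain M where
    M: "\<And>K. K \<ge> 0 \<Longrightarrow> eventually (\<lambda>n. nev_T (\<lambda>z. exp (Q z)) (\<rho> n + K) \<le> M * T (\<rho> n)) sequentially"
    using cQ unfolding comparable_def by blast
  \<comment> \<open>Large enough that \<open>k / s * (2 * \<bar>M\<bar> + 1)\<close> is at most
    \<open>\<epsilon>\<close>; the added 1 keeps s positive when k = 0.\<close>
  define s where "s = k * (2 * \<bar>M\<bar> + 1) / \<epsilon> + 1"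
  have s: "s > 0" using e \<open>k \<ge> 0\<close> by (auto simp: s_def intro!: add_nonneg_pos)
  have ks: "k / s * (2 * \<bar>M\<bar> + 1) \<le> \<epsilon>"
  proof -
    have "k * (2 * \<bar>M\<bar> + 1) \<le> \<epsilon> * s" using e by (simp add: s_def field_simps)
    then show ?thesis using s by (simp add: field_simps)
  qed
  have "eventually (\<lambda>n. nev_T (\<lambda>z. exp (Q z)) (\<rho> n + (K + s + 2)) \<le> M * T (\<rho> n)) sequentially"
    using K s by (intro M) auto
  then show "eventually (\<lambda>n. nev_T F (\<rho> n + K) \<le> \<epsilon> * T (\<rho> n)) sequentially"
    using eventually_const_dominated[OF zero_less_one, of "- Re (Q 0)"]
  proof eventually_elim
    case (elim n)
    have "nev_T F (\<rho> n + K) \<le> k / s * (2 * nev_T (\<lambda>z. exp (Q z)) (\<rho> n + K + s + 2) - Re (Q 0))"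
      using K radius_pos[of n] s by (intro le) auto
    also have "\<dots> \<le> k / s * (2 * (\<bar>M\<bar> * T (\<rho> n)) + T (\<rho> n))"
    proof (intro mult_left_mono)
      have "M * T (\<rho> n) \<le> \<bar>M\<bar> * T (\<rho> n)" by (intro mult_right_mono) auto
      then show "2 * nev_T (\<lambda>z. exp (Q z)) (\<rho> n + K + s + 2) - Re (Q 0) \<le> 2 * (\<bar>M\<bar> * T (\<rho> n)) + T (\<rho> n)"
        using elim by (simp add: add.assoc)
    qed (use \<open>k \<ge> 0\<close> s in auto)
    also have "\<dots> = k / s * (2 * \<bar>M\<bar> + 1) * T (\<rho> n)" by (simp add: algebra_simps)
    also have "\<dots> \<le> \<epsilon> * T (\<rho> n)" by (intro mult_right_mono ks) auto
    finally show ?case .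
  qed
qed

lemma small_deriv_exponent:
  assumes Q: "Q holomorphic_on UNIV" and cQ: "comparable (\<lambda>z. exp (Q z))"
  shows "small (deriv Q)"
proof (rule exponent_estimate[OF Q cQ, of _ 2])
  show "deriv Q holomorphic_on UNIV" using Q by (intro holomorphic_intros) auto
  fix r s :: real assume r: "0 \<le> r" "0 < s"
  have "nev_T (deriv Q) r \<le> 2 / s * (2 * nev_T (\<lambda>z. exp (Q z)) (r + s) - Re (Q 0))"
    by (rule nev_T_deriv_exponent[OF Q r])
  also have "\<dots> \<le> 2 / s * (2 * nev_T (\<lambda>z. exp (Q z)) (r + s + 2) - Re (Q 0))"
    using r by (intro mult_left_mono diff_right_mono nev_T_mono holomorphic_intros Q) auto
  finally show "nev_T (deriv Q) r \<le> 2 / s * (2 * nev_T (\<lambda>z. exp (Q z)) (r + s + 2) - Re (Q 0))" .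
qed auto

lemma small_exp_difference: "small (\<lambda>z. exp (h (z + 1) - h z))"
proof (rule exponent_estimate[OF h comparable_w, of _ 6])
  show "(\<lambda>z. exp (h (z + 1) - h z)) holomorphic_on UNIV"
    by (intro holomorphic_intros h holomorphic_on_compose[OF _ holomorphic_on_subset[OF h], unfolded o_def]) auto
  show "nev_T (\<lambda>z. exp (h (z + 1) - h z)) r \<le> 6 / s * (2 * T (r + s + 2) - Re (h 0))"
    if "0 \<le> r" "0 < s" for r s
    by (rule nev_T_exp_difference[OF h that])
qed auto

text \<open>Where \<open>Re h > 0\<close>, the factor \<open>e\<^sup>-\<^sup>h\<close> makes \<open>c\<^sub>1 + c\<^sub>2 w\<close> tiny, and elsewhere it is bounded by
  small functions; so its logarithmic mean is about \<open>- T\<close>, which Jensen's inequality forbids.\<close>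
lemma small_coefficients_step:
  assumes "small c0" "small c1" "small c2" and eq: "\<And>z. c0 z + w z * (c1 z + c2 z * w z) = 0"
  shows "c1 z + c2 z * w z = 0" "c0 z = 0"
proof -
  define Y where "Y z = c1 z + c2 z * w z" for z
  note hol = small_holomorphic[OF assms(1)] small_holomorphic[OF assms(2)] small_holomorphic[OF assms(3)]
  have Y: "Y holomorphic_on UNIV" unfolding Y_def by (intro holomorphic_intros hol h)
  have Y0: "Y x = 0" for x
  proof (rule ccontr)
    assume "Y x \<noteq> 0"
    then obtain C where C: "\<And>r N. 1 \<le> r \<Longrightarrow> - C \<le> cmean (\<lambda>z. ln (max (cmod (Y z)) (exp (-N)))) 0 r"
      using Jensen_inequality[OF Y] by blast
    define S where "S z = logp c0 z + logp c1 z + logp c2 z + ln 2" for z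
    have S0: "S z \<ge> 0" for z by (auto simp: S_def intro!: add_nonneg_nonneg)
    have cS: "continuous_on UNIV S" unfolding S_def by (intro continuous_intros hol)
    have le: "- C \<le> nev_T c0 r + nev_T c1 r + nev_T c2 r + ln 2 - T r" if r: "1 \<le> r" for r
    proof -
      \<comment> \<open>With N above ln^+ |w| on this circle, the truncation level e^(-N) stays
        below the bound e^(S - ln^+ |w|) sought for Y.\<close>
      obtain N where N: "\<And>z. cmod z = r \<Longrightarrow> logp w z \<le> N"
        using entire_bounded_on_sphere[OF continuous_on_logp[OF w_holomorphic]] by blast
      have "- C \<le> cmean (\<lambda>z. ln (max (cmod (Y z)) (exp (-N)))) 0 r" by (rule C[OF r])
      also have "\<dots> \<le> cmean (\<lambda>z. S z - logp w z) 0 r"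
      proof (rule cmean_mono)
        show "continuous_on UNIV (\<lambda>z. ln (max (cmod (Y z)) (exp (-N))))" by (rule continuous_on_ln_truncated[OF Y])
        show "continuous_on UNIV (\<lambda>z. S z - logp w z)" by (intro continuous_intros cS w_holomorphic)
        fix z :: complex assume "cmod (z - 0) = r"
        then have z: "logp w z \<le> N" using N by simp
        have "cmod (Y z) \<le> exp (S z - logp w z)"
        proof (cases "Re (h z) \<ge> 0")
          case True
          have "w z * Y z = - c0 z" using eq[of z] by (simp add: Y_def eq_neg_iff_add_eq_0 add.commute)
          then have "cmod (w z * Y z) = cmod (c0 z)" by simp
          then have "cmod (Y z) = cmod (c0 z) * exp (- Re (h z))" by (simp add: norm_mult exp_minus field_simps)
          also have "\<dots> \<le> exp (logp c0 z) * exp (- Re (h z))" by (intro mult_right_mono le_logp) auto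
          also have "\<dots> = exp (logp c0 z - logp w z)" using True by (simp add: logp_exp exp_diff exp_minus field_simps)
          also have "\<dots> \<le> exp (S z - logp w z)"
            using logp_nonneg[of c1 z] logp_nonneg[of c2 z] ln_ge_zero[of 2] by (simp add: S_def del: logp_nonneg)
          finally show ?thesis .
        next
          case False
          have "cmod (Y z) \<le> cmod (c1 z) + cmod (c2 z) * exp (Re (h z))"
            unfolding Y_def by (rule order_trans[OF norm_triangle_ineq]) (simp add: norm_mult)
          also have "\<dots> \<le> exp (logp c1 z) + exp (logp c2 z) * 1"
            using False by (intro add_mono mult_mono le_logp) auto
          also have "\<dots> \<le> exp (logp c1 z + logp c2 z) + exp (logp c1 z + logp c2 z)"
            by (intro add_mono) auto
          also have "\<dots> = exp (logp c1 z + logp c2 z + ln 2)" by (simp add: exp_add)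
          also have "\<dots> \<le> exp (S z - logp w z)" using False by (simp add: S_def logp_exp)
          finally show ?thesis .
        qed
        moreover have "exp (- N) \<le> exp (S z - logp w z)" using z S0[of z] by simp
        ultimately have "max (cmod (Y z)) (exp (-N)) \<le> exp (S z - logp w z)" by simp
        moreover have "0 < max (cmod (Y z)) (exp (-N))" by (simp add: less_max_iff_disj)
        ultimately have "ln (max (cmod (Y z)) (exp (-N))) \<le> ln (exp (S z - logp w z))" by (intro ln_mono) auto
        then show "ln (max (cmod (Y z)) (exp (-N))) \<le> S z - logp w z" by simp
      qed (use r in auto)
      also have "\<dots> = nev_T c0 r + nev_T c1 r + nev_T c2 r + ln 2 - T r"
        unfolding S_def
        by (simp add: cmean_diff cmean_add continuous_intros hol w_holomorphic cmean_const nev_T_eq_cmean)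
      finally show ?thesis .
    qed
    \<comment> \<open>Three small functions and the constant, at one sixth each, would give T <=
      (4/6) T - 1, impossible for T >= 0.\<close>
    have e: "(1/6::real) > 0" by simp
    have "eventually (\<lambda>n. False) sequentially"
      using smallD[OF assms(1) order_refl e] smallD[OF assms(2) order_refl e] smallD[OF assms(3) order_refl e]
        eventually_const_dominated[OF e, of "C + ln 2 + 1"] 
    proof eventually_elim
      case (elim n)
      have "1 \<le> \<rho> n" using radii[of n] by simp
      from le[OF this] elim nev_T_nonneg[of w "\<rho> n"] show ?case by simp
    qed
    then show False by simp
  qed
  show "c1 z + c2 z * w z = 0" using Y0[of z] by (simp add: Y_def)
  with eq[of z] show "c0 z = 0" by simp
qed

lemma small_linear_independent:
  assumes "small c0" "small c1" "\<And>z. c0 z + c1 z * w z = 0"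
  shows "c0 z = 0" "c1 z = 0"
proof -
  have "c0 z + w z * (c1 z + 0 * w z) = 0" for z using assms(3)[of z] by (simp add: mult.commute)
  from small_coefficients_step[OF assms(1,2) small_const this]
  show "c0 z = 0" "c1 z = 0" by simp_all
qed

text \<open>The step lemma removes the constant term and a factor \<open>w\<close>; what remains is
  a linear relation.\<close>

lemma small_quadratic_independent:
  assumes "small c0" "small c1" "small c2" "\<And>z. c0 z + c1 z * w z + c2 z * (w z)\<^sup>2 = 0"
  shows "c0 z = 0" "c1 z = 0" "c2 z = 0"
proof -
  have eq: "c0 z + w z * (c1 z + c2 z * w z) = 0" for z
    using assms(4)[of z] by (simp add: algebra_simps power2_eq_square)
  note 1 = small_coefficients_step[OF assms(1-3) eq]
  show "c0 z = 0" by (rule 1(2))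
  show "c1 z = 0" "c2 z = 0" using small_linear_independent[OF assms(2,3) 1(1)] by auto
qed

end

subsection \<open>Eliminating between the shared-value identity and its derivative\<close>

lemma entire_eq_0_of_ball:
  fixes f :: "complex \<Rightarrow> complex"
  assumes "f holomorphic_on UNIV" "r > 0" "\<And>z. z \<in> ball x r \<Longrightarrow> f z = 0"
  shows "f z = 0"
proof (rule analytic_continuation_open[of "ball x r" UNIV f "\<lambda>_. 0"])
qed (use assms in auto)

lemma entire_nonzero_ball:
  fixes g :: "complex \<Rightarrow> complex"
  assumes "g holomorphic_on UNIV" "g x \<noteq> 0"
  obtains r where "r > 0" "\<And>z. z \<in> ball x r \<Longrightarrow> g z \<noteq> 0"
proof -
  have "isCont g x" using entire_continuous[OF assms(1)] by (simp add: continuous_on_eq_continuous_at)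
  from continuous_at_avoid[OF this assms(2)] obtain r where "r > 0" "\<And>y. dist x y < r \<Longrightarrow> g y \<noteq> 0"
    by auto
  then show ?thesis using that by auto
qed

lemma entire_mult_eq_0:
  fixes f g :: "complex \<Rightarrow> complex"
  assumes "f holomorphic_on UNIV" "g holomorphic_on UNIV" "g x \<noteq> 0" "\<And>z. f z * g z = 0"
  shows "f z = 0"
proof -
  obtain r where r: "r > 0" "\<And>z. z \<in> ball x r \<Longrightarrow> g z \<noteq> 0" using entire_nonzero_ball[OF assms(2,3)] by blast
  show ?thesis by (rule entire_eq_0_of_ball[OF assms(1) r(1), of x]) (use assms(4) r(2) in force)
qed

text \<open>The hypothesis says that g/f has derivative 0. Since f may have zeros, the quotient is
  formed only on a ball without zeros, and the identity theorem extends the proportionality.\<close>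

lemma entire_Wronskian_eq_0:
  fixes f g :: "complex \<Rightarrow> complex"
  assumes f: "f holomorphic_on UNIV" "f x \<noteq> 0" and g: "g holomorphic_on UNIV"
    and eq: "\<And>z. deriv f z * g z = f z * deriv g z"
  obtains c where "\<And>z. g z = c * f z"
proof -
  obtain r where r: "r > 0" "\<And>z. z \<in> ball x r \<Longrightarrow> f z \<noteq> 0" using entire_nonzero_ball[OF f] by blast
  have df: "(f has_field_derivative deriv f z) (at z)" and dg: "(g has_field_derivative deriv g z) (at z)" for z
    using f g by (auto intro: holomorphic_derivI)
  have "\<exists>c. \<forall>z\<in>ball x r. g z / f z = c"
  proof (rule has_field_derivative_zero_constant[of "ball x r" "\<lambda>z. g z / f z"])
    fix z assume z: "z \<in> ball x r"
    have "((\<lambda>z. g z / f z) has_field_derivative (deriv g z * f z - g z * deriv f z) / (f z * f z)) (at z)"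
      using r(2)[OF z] by (rule DERIV_divide[OF dg df])
    moreover have "deriv g z * f z - g z * deriv f z = 0" using eq[of z] by (simp add: mult.commute)
    ultimately show "((\<lambda>z. g z / f z) has_field_derivative 0) (at z within ball x r)"
      by (auto intro: has_field_derivative_at_within)
  qed auto
  then obtain c where c: "\<And>z. z \<in> ball x r \<Longrightarrow> g z / f z = c" by blast
  have "g z - c * f z = 0" for z
  proof (rule entire_eq_0_of_ball[of "\<lambda>z. g z - c * f z", OF _ r(1), of x])
    show "(\<lambda>z. g z - c * f z) holomorphic_on UNIV" by (intro holomorphic_intros f g)
    show "g z - c * f z = 0" if "z \<in> ball x r" for z using c[OF that] r(2)[OF that] by (simp add: field_simps)
  qed
  then show ?thesis using that[of c] by simp
qed

text \<open>As a quotient of comparable functions, E is comparable, so E'/E is small.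
  Differentiation therefore reproduces the identity with small coefficients, and elimination
  expresses E through \<open>w\<close> unless the determinant \<open>\<gamma>\<close> vanishes
  identically. That degenerate case is treated by Wronskians.\<close>

lemma (in doubling_exponential) shared_value_ratio:
  assumes small: "small A" "small B" "small P1" "small P2"
    and nz: "P1 x1 \<noteq> 0" "P2 x2 \<noteq> 0"
    and E: "E holomorphic_on UNIV" "\<And>z. E z \<noteq> 0"
    and eq: "\<And>z. A z + P1 z * w z = E z * (B z + P2 z * w z)"
  shows "P1 z = E z * P2 z" "A z = E z * B z"
proof -
  note hol = small[THEN small_holomorphic]
  obtain Q where Q: "Q holomorphic_on UNIV" "\<And>z. exp (Q z) = E z"
    using holomorphic_logarithm_exists[of UNIV E 0] E by auto
  have EQ: "(\<lambda>z. exp (Q z)) = E" using Q(2) by auto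
  note cmp = small[THEN small_imp_comparable]
  have cG: "comparable (\<lambda>z. B z + P2 z * w z)"
    by (rule comparable_add[OF cmp(2) comparable_mult[OF cmp(4) comparable_w]])
  have "comparable (\<lambda>z. A z + P1 z * w z)"
    by (rule comparable_add[OF cmp(1) comparable_mult[OF cmp(3) comparable_w]])
  then have cEG: "comparable (\<lambda>z. E z * (B z + P2 z * w z))" by (simp only: eq)
  obtain y where y: "B y + P2 y * w y \<noteq> 0"
  proof -
    have "\<exists>y. B y + P2 y * w y \<noteq> 0"
    proof (rule ccontr)
      assume "\<not> ?thesis"
      then have "B z + P2 z * w z = 0" for z by blast
      from small_linear_independent(2)[OF small(2,4) this] nz(2) show False by simp
    qed
    then show ?thesis using that by blast
  qed
  have "comparable E" by (rule comparable_quotient[OF E(1) cEG cG y])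
  then have sQ: "small (deriv Q)" using small_deriv_exponent[OF Q(1)] EQ by simp
  have sh: "small (deriv h)" by (rule small_deriv_exponent[OF h comparable_w])
  note sd = small[THEN small_deriv]
  \<comment> \<open>Coefficients after differentiation: (P1 w)' = P1s w, (E P2 w)' = E P2s w and (E
    B)' = E Bs.\<close>
  define P1s where "P1s z = deriv P1 z + P1 z * deriv h z" for z
  define P2s where "P2s z = deriv P2 z + P2 z * (deriv h z + deriv Q z)" for z
  define Bs where "Bs z = deriv B z + B z * deriv Q z" for z
  have s: "small P1s" "small P2s" "small Bs"
    unfolding P1s_def [abs_def] P2s_def [abs_def] Bs_def [abs_def]
    by (intro small_add small_mult sd sh sQ small)+
  have D: "(A has_field_derivative deriv A z) (at z)" "(B has_field_derivative deriv B z) (at z)"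
    "(P1 has_field_derivative deriv P1 z) (at z)" "(P2 has_field_derivative deriv P2 z) (at z)"
    "(h has_field_derivative deriv h z) (at z)" "(Q has_field_derivative deriv Q z) (at z)" for z
    using hol h Q(1) by (auto intro: holomorphic_derivI)
  have DE: "(E has_field_derivative E z * deriv Q z) (at z)" for z
    unfolding EQ[symmetric] by (auto intro!: derivative_eq_intros D)
  have Dw: "(w has_field_derivative w z * deriv h z) (at z)" for z
    by (auto intro!: derivative_eq_intros D)
  have eq': "deriv A z + P1s z * w z = E z * (Bs z + P2s z * w z)" for z
  proof -
    have 1: "((\<lambda>z. A z + P1 z * w z) has_field_derivative deriv A z + P1s z * w z) (at z)"
      by (auto intro!: derivative_eq_intros D simp: P1s_def algebra_simps)
    have 2: "((\<lambda>z. E z * (B z + P2 z * w z)) has_field_derivative E z * (Bs z + P2s z * w z)) (at z)"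
      by (auto intro!: derivative_eq_intros D DE simp: P2s_def Bs_def algebra_simps)
    have "(\<lambda>z. A z + P1 z * w z) = (\<lambda>z. E z * (B z + P2 z * w z))" using eq by auto
    with 1 2 show ?thesis using DERIV_unique by metis
  qed
  \<comment> \<open>The 2 x 2 determinants that eliminate the w E term between the identity and its
    derivative.\<close>
  define \<alpha> where "\<alpha> z = P2s z * A z - P2 z * deriv A z" for z
  define \<beta> where "\<beta> z = P2s z * P1 z - P2 z * P1s z" for z
  define \<gamma> where "\<gamma> z = P2s z * B z - P2 z * Bs z" for z
  have abc: "small \<alpha>" "small \<beta>" "small \<gamma>"
    unfolding \<alpha>_def [abs_def] \<beta>_def [abs_def] \<gamma>_def [abs_def]
    by (intro small_diff small_mult s sd small)+
  note abc_hol = abc[THEN small_holomorphic]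
  have elim: "\<alpha> z + \<beta> z * w z = \<gamma> z * E z" for z
  proof -
    have "\<alpha> z + \<beta> z * w z = P2s z * (A z + P1 z * w z) - P2 z * (deriv A z + P1s z * w z)"
      by (simp add: \<alpha>_def \<beta>_def algebra_simps)
    also have "\<dots> = \<gamma> z * E z" unfolding eq eq' by (simp add: \<gamma>_def algebra_simps)
    finally show ?thesis .
  qed
  \<comment> \<open>The relation \<alpha> + \<beta> w = \<gamma> E is multiplied by B + P2 w, and E
    (B + P2 w) is replaced by A + P1 w; so E disappears.\<close>
  have quad: "(\<gamma> z * A z - \<alpha> z * B z) + (\<gamma> z * P1 z - \<beta> z * B z - \<alpha> z * P2 z) * w z
      + (- (\<beta> z * P2 z)) * (w z)\<^sup>2 = 0" for z
  proof -
    have "(\<gamma> z * A z - \<alpha> z * B z) + (\<gamma> z * P1 z - \<beta> z * B z - \<alpha> z * P2 z) * w z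
      + (- (\<beta> z * P2 z)) * (w z)\<^sup>2 = \<gamma> z * (A z + P1 z * w z) - (\<alpha> z + \<beta> z * w z) * (B z + P2 z * w z)"
      by (simp add: algebra_simps power2_eq_square)
    also have "\<dots> = 0" unfolding eq elim by simp
    finally show ?thesis .
  qed
  have c: "\<gamma> z * A z - \<alpha> z * B z = 0" "\<gamma> z * P1 z - \<beta> z * B z - \<alpha> z * P2 z = 0" "- (\<beta> z * P2 z) = 0" for z
    by (rule small_quadratic_independent[OF _ _ _ quad]; intro small_diff small_mult small_minus abc small)+
  have \<beta>0: "\<beta> z = 0" for z
    by (rule entire_mult_eq_0[OF abc_hol(2) hol(4) nz(2)]) (use c(3) in simp)
  show "P1 z = E z * P2 z" "A z = E z * B z"
  proof (atomize(full), cases "\<exists>y. \<gamma> y \<noteq> 0")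
    case True
    then obtain y where y: "\<gamma> y \<noteq> 0" by blast
    \<comment> \<open>Now \<open>\<alpha>\<close> = \<open>\<gamma>\<close> E, and the constant and
      linear coefficients of the quadratic relation are \<open>\<gamma>\<close> times the two
      differences to be shown zero.\<close>
    have \<alpha>: "\<alpha> z = \<gamma> z * E z" for z using elim[of z] by (simp add: \<beta>0)
    have "P1 z - E z * P2 z = 0"
    proof (rule entire_mult_eq_0[of "\<lambda>z. P1 z - E z * P2 z", OF _ abc_hol(3) y])
      show "(\<lambda>z. P1 z - E z * P2 z) holomorphic_on UNIV" by (intro holomorphic_intros hol E)
      show "(P1 z - E z * P2 z) * \<gamma> z = 0" for z using c(2)[of z] by (simp add: \<alpha> \<beta>0 algebra_simps)
    qed
    moreover have "A z - E z * B z = 0"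
    proof (rule entire_mult_eq_0[of "\<lambda>z. A z - E z * B z", OF _ abc_hol(3) y])
      show "(\<lambda>z. A z - E z * B z) holomorphic_on UNIV" by (intro holomorphic_intros hol E)
      show "(A z - E z * B z) * \<gamma> z = 0" for z using c(1)[of z] by (simp add: \<alpha> algebra_simps)
    qed
    ultimately show "P1 z = E z * P2 z \<and> A z = E z * B z" by simp
  next
    case False
    then have \<gamma>0: "\<gamma> z = 0" for z by blast
    then have \<alpha>0: "\<alpha> z = 0" for z using elim[of z] \<beta>0 by simp
    \<comment> \<open>All three determinants vanish. Up to zero-free factors they are the Wronskians
      of B and P2 w, of P1 and P2 E, and of A and P2 w E, so each pair is proportional. Smallness
      then forces B = 0 and A = 0, and comparing constants leaves P1 = E P2.\<close>
    have wh: "w holomorphic_on UNIV" by (rule w_holomorphic)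
    obtain c where c: "\<And>z. B z = c * (P2 z * w z)"
    proof (rule entire_Wronskian_eq_0[of "\<lambda>z. P2 z * w z" x2 B])
      fix z
      have d: "deriv (\<lambda>z. P2 z * w z) z = deriv P2 z * w z + P2 z * (w z * deriv h z)"
        by (rule DERIV_imp_deriv) (auto intro!: derivative_eq_intros D simp: algebra_simps)
      have "deriv (\<lambda>z. P2 z * w z) z * B z - P2 z * w z * deriv B z = w z * \<gamma> z"
        unfolding d by (simp add: \<gamma>_def P2s_def Bs_def algebra_simps)
      then show "deriv (\<lambda>z. P2 z * w z) z * B z = P2 z * w z * deriv B z" by (simp add: \<gamma>0)
    qed (use nz(2) in \<open>auto intro!: holomorphic_intros hol h\<close>)
    have B0: "B z = 0" for z
    proof (rule small_linear_independent(1)[OF small(2), of "\<lambda>z. - (c * P2 z)"])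
      show "small (\<lambda>z. - (c * P2 z))" by (intro small_minus small_mult small_const small)
      show "B z + - (c * P2 z) * w z = 0" for z by (simp add: c)
    qed
    obtain k where k: "\<And>z. P1 z = k * (P2 z * E z)"
    proof (rule entire_Wronskian_eq_0[of "\<lambda>z. P2 z * E z" x2 P1])
      fix z
      have d: "deriv (\<lambda>z. P2 z * E z) z = deriv P2 z * E z + P2 z * (E z * deriv Q z)"
        by (rule DERIV_imp_deriv) (auto intro!: derivative_eq_intros D DE simp: algebra_simps)
      have "deriv (\<lambda>z. P2 z * E z) z * P1 z - P2 z * E z * deriv P1 z = E z * \<beta> z"
        unfolding d by (simp add: \<beta>_def P2s_def P1s_def algebra_simps)
      then show "deriv (\<lambda>z. P2 z * E z) z * P1 z = P2 z * E z * deriv P1 z" by (simp add: \<beta>0)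
    qed (use nz(2) E in \<open>auto intro!: holomorphic_intros hol h\<close>)
    obtain d where d: "\<And>z. A z = d * (P2 z * w z * E z)"
    proof (rule entire_Wronskian_eq_0[of "\<lambda>z. P2 z * w z * E z" x2 A])
      fix z
      have d: "deriv (\<lambda>z. P2 z * w z * E z) z = (deriv P2 z * w z + P2 z * (w z * deriv h z)) * E z + P2 z * w z * (E z * deriv Q z)"
        by (rule DERIV_imp_deriv) (auto intro!: derivative_eq_intros D DE simp: algebra_simps)
      have "deriv (\<lambda>z. P2 z * w z * E z) z * A z - P2 z * w z * E z * deriv A z = w z * E z * \<alpha> z"
        unfolding d by (simp add: \<alpha>_def P2s_def algebra_simps)
      then show "deriv (\<lambda>z. P2 z * w z * E z) z * A z = P2 z * w z * E z * deriv A z" by (simp add: \<alpha>0)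
    qed (use nz(2) E in \<open>auto intro!: holomorphic_intros hol h\<close>)
    have "(d + k - 1) * (P2 x2 * w x2 * E x2) = 0"
      using eq[of x2] by (simp add: d[of x2] k[of x2] B0 algebra_simps)
    then have dk: "d + k = 1" using nz(2) E(2)[of x2] by simp
    have k0: "k \<noteq> 0" using nz(1) k[of x1] by auto
    have A0: "A z = 0" for z
    proof (rule small_linear_independent(1)[OF small(1), of "\<lambda>z. - (d / k * P1 z)"])
      show "small (\<lambda>z. - (d / k * P1 z))" by (intro small_minus small_mult small_const small)
      show "A z + - (d / k * P1 z) * w z = 0" for z using k0 by (simp add: d[of z] k[of z])
    qed
    then have "d = 0" using d[of x2] nz(2) E(2)[of x2] by simp
    with dk k[of z] have "P1 z = E z * P2 z" by simp
    then show "P1 z = E z * P2 z \<and> A z = E z * B z" by (simp add: A0 B0)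
  qed
qed

subsection \<open>Exceptional sets and growth\<close>

text \<open>An interval longer than the measure of \<open>E\<close> cannot lie inside
  \<open>E\<close>.\<close>

lemma avoid_finite_measure:
  assumes "E \<in> sets lborel" "emeasure lborel E < \<infinity>"
  obtains m :: real where "m > 0" "\<And>r. \<exists>R. r < R \<and> R < r + m \<and> R \<notin> E"
proof
  define m where "m = measure lborel E + 1"
  show "m > 0" by (simp add: m_def add_nonneg_pos)
  fix r :: real
  show "\<exists>R. r < R \<and> R < r + m \<and> R \<notin> E"
  proof (rule ccontr)
    assume "\<not> ?thesis"
    then have "{r<..<r + m} \<subseteq> E" by auto
    then have "emeasure lborel {r<..<r + m} \<le> emeasure lborel E" by (rule emeasure_mono[OF _ assms(1)])
    also have "\<dots> = ennreal (measure lborel E)" using assms by (intro emeasure_eq_ennreal_measure) auto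
    finally have "m \<le> measure lborel E" using \<open>m > 0\<close> by (simp add: ennreal_le_iff)
    then show False by (simp add: m_def)
  qed
qed

lemma small_function_bound:
  assumes g: "g holomorphic_on UNIV" and f: "f holomorphic_on UNIV" and sf: "small_function g f"
  obtains m where "m > 0" "\<And>\<epsilon>. \<epsilon> > 0 \<Longrightarrow> eventually (\<lambda>r. \<exists>R. r \<le> R \<and> R \<le> r + m \<and> nev_T g R \<le> \<epsilon> * nev_T f R) at_top"
proof -
  obtain E where E: "E \<in> sets lborel" "emeasure lborel E < \<infinity>"
    "\<And>\<epsilon>. \<epsilon> > 0 \<Longrightarrow> \<exists>R. \<forall>r. r > R \<and> r \<notin> E \<longrightarrow> \<bar>nev_T g r\<bar> \<le> \<epsilon> * \<bar>nev_T f r\<bar>"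
    using sf unfolding small_function_def by blast
  obtain m where m: "m > 0" "\<And>r. \<exists>R. r < R \<and> R < r + m \<and> R \<notin> E" using avoid_finite_measure[OF E(1,2)] by blast
  have "eventually (\<lambda>r. \<exists>R. r \<le> R \<and> R \<le> r + m \<and> nev_T g R \<le> \<epsilon> * nev_T f R) at_top" if e: "\<epsilon> > 0" for \<epsilon>
  proof -
    obtain R0 where R0: "\<And>r. r > R0 \<Longrightarrow> r \<notin> E \<Longrightarrow> nev_T g r \<le> \<epsilon> * nev_T f r" using E(3)[OF e] by auto
    show ?thesis using eventually_gt_at_top[of R0]
    proof eventually_elim
      case (elim r)
      obtain R where "r < R" "R < r + m" "R \<notin> E" using m(2) by blast
      with R0[of R] elim show ?case by (intro exI[of _ R]) auto
    qed
  qed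
  with m(1) that show ?thesis by blast
qed

text \<open>Monotonicity of both characteristics trades the exceptional set for a shift
  \<open>m\<close>, which depends on that set only and not on \<open>\<epsilon>\<close>.\<close>

lemma small_function_nev_T_le:
  assumes g: "g holomorphic_on UNIV" and f: "f holomorphic_on UNIV" and sf: "small_function g f"
  obtains m where "m > 0" "\<And>\<epsilon>. \<epsilon> > 0 \<Longrightarrow> eventually (\<lambda>r. nev_T g r \<le> \<epsilon> * nev_T f (r + m)) at_top"
proof -
  obtain m where m: "m > 0" "\<And>\<epsilon>. \<epsilon> > 0 \<Longrightarrow> eventually (\<lambda>r. \<exists>R. r \<le> R \<and> R \<le> r + m \<and> nev_T g R \<le> \<epsilon> * nev_T f R) at_top"
    using small_function_bound[OF assms] by blast
  have "eventually (\<lambda>r. nev_T g r \<le> \<epsilon> * nev_T f (r + m)) at_top" if e: "\<epsilon> > 0" for \<epsilon>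
    using m(2)[OF e] eventually_ge_at_top[of 0]
  proof eventually_elim
    case (elim r)
    then obtain R where R: "r \<le> R" "R \<le> r + m" "nev_T g R \<le> \<epsilon> * nev_T f R" by blast
    have "nev_T g r \<le> nev_T g R" by (rule nev_T_mono[OF g]) (use R elim in auto)
    also note R(3)
    also have "\<epsilon> * nev_T f R \<le> \<epsilon> * nev_T f (r + m)"
      using R elim e by (intro mult_left_mono nev_T_mono[OF f]) auto
    finally show ?case .
  qed
  with m(1) that show ?thesis by blast
qed

text \<open>At a radius where T(a) <= T(f)/2, this term of the triangle inequality is absorbed on
  the left; such a radius exists within distance m.\<close>

lemma nev_T_le_difference:
  assumes a: "a holomorphic_on UNIV" and f: "f holomorphic_on UNIV" and sf: "small_function a f"
  obtains m where "m > 0" "eventually (\<lambda>r. nev_T f r \<le> 2 * nev_T (\<lambda>z. f z - a z) (r + m) + 2 * ln 2) at_top"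
proof -
  have fa: "(\<lambda>z. f z - a z) holomorphic_on UNIV" by (intro holomorphic_intros a f)
  obtain m where m: "m > 0" "\<And>\<epsilon>. \<epsilon> > 0 \<Longrightarrow> eventually (\<lambda>r. \<exists>R. r \<le> R \<and> R \<le> r + m \<and> nev_T a R \<le> \<epsilon> * nev_T f R) at_top"
    using small_function_bound[OF assms] by blast
  have half: "(1/2::real) > 0" by simp
  have "eventually (\<lambda>r. nev_T f r \<le> 2 * nev_T (\<lambda>z. f z - a z) (r + m) + 2 * ln 2) at_top"
    using m(2)[OF half] eventually_ge_at_top[of 0]
  proof eventually_elim
    case (elim r)
    then obtain R where R: "r \<le> R" "R \<le> r + m" "nev_T a R \<le> 1/2 * nev_T f R" by blast
    have "nev_T f R \<le> nev_T (\<lambda>z. f z - a z) R + nev_T a R + ln 2"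
      using nev_T_add[OF fa a, of R] R elim by simp
    then have "nev_T f R \<le> 2 * nev_T (\<lambda>z. f z - a z) R + 2 * ln 2" using R(3) by simp
    moreover have "nev_T f r \<le> nev_T f R" by (rule nev_T_mono[OF f]) (use R elim in auto)
    moreover have "nev_T (\<lambda>z. f z - a z) R \<le> nev_T (\<lambda>z. f z - a z) (r + m)"
      by (rule nev_T_mono[OF fa]) (use R elim in auto)
    ultimately show ?case by linarith
  qed
  with m(1) that show ?thesis by blast
qed

text \<open>Some s < 1 gives T <= exp(r^s), and r^s is eventually below every positive multiple of
  r.\<close>

lemma hyper_order_less_one_growth:
  assumes "nev_hyper_order f < 1" and d: "\<delta> > 0"
  shows "eventually (\<lambda>r. nev_T f r \<le> exp (\<delta> * r)) at_top"
proof -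
  obtain s0 :: real where s0: "nev_hyper_order f < ereal s0" "ereal s0 < 1"
    using ereal_dense2[OF assms(1)] by blast
  define s where "s = max 0 s0"
  have s: "0 \<le> s" "s < 1" using s0(2) by (auto simp: s_def)
  have "eventually (\<lambda>r. ereal (lnplus (lnplus (nev_T f r)) / ln r) < ereal s0) at_top"
    using s0(1) unfolding nev_hyper_order_def by (rule Limsup_lessD)
  moreover have "eventually (\<lambda>r. r powr s \<le> \<delta> * r) at_top" using s d by real_asymp
  ultimately show ?thesis using eventually_gt_at_top[of 1]
  proof eventually_elim
    case (elim r)
    then have "lnplus (lnplus (nev_T f r)) \<le> s0 * ln r" by (simp add: field_simps)
    also have "\<dots> \<le> s * ln r" using elim by (intro mult_right_mono) (auto simp: s_def)
    finally have "lnplus (nev_T f r) \<le> exp (s * ln r)"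
      using elim s by (subst (asm) lnplus_le_iff) auto
    also have "\<dots> \<le> \<delta> * r" using elim by (simp add: powr_def)
    finally show ?case using elim d by (subst (asm) lnplus_le_iff) auto
  qed
qed

text \<open>Growth at most order one, minimal type. Unlike \<open>small\<close>, it is an absolute
  bound for all large r.\<close>

definition minimal_type :: "(complex \<Rightarrow> complex) \<Rightarrow> bool" where
  "minimal_type g \<longleftrightarrow> g holomorphic_on UNIV \<and> (\<forall>\<delta>>0. eventually (\<lambda>r. nev_T g r \<le> \<delta> * r) at_top)"

lemma minimal_type_add:
  assumes "minimal_type f" "minimal_type g"
  shows "minimal_type (\<lambda>z. f z + g z)"
  unfolding minimal_type_def
proof (intro conjI allI impI)
  have hol: "f holomorphic_on UNIV" "g holomorphic_on UNIV" using assms by (auto simp: minimal_type_def)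
  show "(\<lambda>z. f z + g z) holomorphic_on UNIV" by (intro holomorphic_intros hol)
  fix \<delta> :: real assume "\<delta> > 0"
  then have d: "\<delta> / 3 > 0" by simp
  have "eventually (\<lambda>r. nev_T f r \<le> \<delta> / 3 * r) at_top" "eventually (\<lambda>r. nev_T g r \<le> \<delta> / 3 * r) at_top"
    using assms d unfolding minimal_type_def by blast+
  moreover have "eventually (\<lambda>r. ln 2 \<le> \<delta> / 3 * r) at_top" using d by real_asymp
  ultimately show "eventually (\<lambda>r. nev_T (\<lambda>z. f z + g z) r \<le> \<delta> * r) at_top" using eventually_ge_at_top[of 0]
  proof eventually_elim
    case (elim r)
    then show ?case using nev_T_add[OF hol, of r] by simp
  qed
qed

lemma minimal_type_mult:
  assumes "minimal_type f" "minimal_type g"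
  shows "minimal_type (\<lambda>z. f z * g z)"
  unfolding minimal_type_def
proof (intro conjI allI impI)
  have hol: "f holomorphic_on UNIV" "g holomorphic_on UNIV" using assms by (auto simp: minimal_type_def)
  show "(\<lambda>z. f z * g z) holomorphic_on UNIV" by (intro holomorphic_intros hol)
  fix \<delta> :: real assume "\<delta> > 0"
  then have d: "\<delta> / 2 > 0" by simp
  have "eventually (\<lambda>r. nev_T f r \<le> \<delta> / 2 * r) at_top" "eventually (\<lambda>r. nev_T g r \<le> \<delta> / 2 * r) at_top"
    using assms d unfolding minimal_type_def by blast+
  then show "eventually (\<lambda>r. nev_T (\<lambda>z. f z * g z) r \<le> \<delta> * r) at_top" using eventually_ge_at_top[of 0]
  proof eventually_elim
    case (elim r)
    then show ?case using nev_T_mult[OF hol, of r] by simp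
  qed
qed

lemma minimal_type_poly: "minimal_type (poly p)"
  unfolding minimal_type_def
proof (intro conjI allI impI)
  show "poly p holomorphic_on UNIV" by (intro holomorphic_intros)
  fix \<delta> :: real assume d: "\<delta> > 0"
  obtain C where C: "C \<ge> 0" "\<And>r. 1 \<le> r \<Longrightarrow> nev_T (poly p) r \<le> C * (1 + ln r)" using nev_T_poly by blast
  have "eventually (\<lambda>r. C * (1 + ln r) \<le> \<delta> * r) at_top" using d by real_asymp
  then show "eventually (\<lambda>r. nev_T (poly p) r \<le> \<delta> * r) at_top" using eventually_ge_at_top[of 1]
    by eventually_elim (use C(2) in force)
qed

text \<open>The pointwise bound on h' is exponential with rate \<delta>/4 at radius 2r, that is
  \<delta>/2 in r; this leaves room for the constants, and one logarithm gives \<delta> r.\<close>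

lemma minimal_type_deriv_exponent:
  assumes h: "h holomorphic_on UNIV"
    and growth: "\<And>\<delta>. \<delta> > 0 \<Longrightarrow> eventually (\<lambda>r. nev_T (\<lambda>z. exp (h z)) r \<le> exp (\<delta> * r)) at_top"
  shows "minimal_type (deriv h)"
  unfolding minimal_type_def
proof (intro conjI allI impI)
  show h': "deriv h holomorphic_on UNIV" using h by (intro holomorphic_intros) auto
  fix \<delta> :: real assume d: "\<delta> > 0"
  define c where "c = \<bar>Re (h 0)\<bar>"
  have "filterlim (\<lambda>r. 2 * r :: real) at_top at_top" by real_asymp
  then have "eventually (\<lambda>r. nev_T (\<lambda>z. exp (h z)) (2 * r) \<le> exp (\<delta> / 4 * (2 * r))) at_top"
    using d by (intro eventually_compose_filterlim[OF growth]) auto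
  moreover have "eventually (\<lambda>r. 6 * (2 * exp (\<delta> / 4 * (2 * r)) + c) \<le> exp (\<delta> * r)) at_top"
    using d by real_asymp
  ultimately show "eventually (\<lambda>r. nev_T (deriv h) r \<le> \<delta> * r) at_top" using eventually_ge_at_top[of 1]
  proof eventually_elim
    case (elim r)
    have "nev_T (deriv h) r \<le> cmean (\<lambda>z. \<delta> * r) 0 r"
      unfolding nev_T_eq_cmean
    proof (rule cmean_mono)
      fix z :: complex assume "cmod (z - 0) = r"
      then have "cmod (deriv h z) \<le> 12 / (2 * r) * (2 * nev_T (\<lambda>z. exp (h z)) (2 * r) - Re (h 0))"
        using elim by (intro deriv_exponent_le[OF h]) auto
      also have "\<dots> \<le> 12 / (2 * r) * (2 * exp (\<delta> / 4 * (2 * r)) + c)"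
        using elim by (intro mult_left_mono) (auto simp: c_def)
      also have "\<dots> \<le> 6 * (2 * exp (\<delta> / 4 * (2 * r)) + c)"
        using elim by (intro mult_right_mono) (auto simp: c_def field_simps intro!: add_nonneg_nonneg)
      also have "\<dots> \<le> exp (\<delta> * r)" using elim by simp
      finally show "logp (deriv h) z \<le> \<delta> * r" using d elim by (simp add: logp_def lnplus_le_iff)
    qed (use elim in \<open>auto intro!: continuous_intros h'\<close>)
    then show ?case by (simp add: cmean_const)
  qed
qed

lemma minimal_type_exp_bound:
  assumes g: "minimal_type g" and e: "\<epsilon> > 0"
  obtains C where "C > 0" "\<And>z. cmod (g z) \<le> C * exp (\<epsilon> * cmod z)"
proof -
  have hol: "g holomorphic_on UNIV" using g by (simp add: minimal_type_def)
  \<comment> \<open>The 6 is 3 * 2 from \<open>logp g z\<close> <= 3 T(2|z|).\<close>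
  have "\<epsilon> / 6 > 0" using e by simp
  with g have "eventually (\<lambda>r. nev_T g r \<le> \<epsilon> / 6 * r) at_top" unfolding minimal_type_def by blast
  then obtain R where R: "\<And>r. r \<ge> R \<Longrightarrow> nev_T g r \<le> \<epsilon> / 6 * r" unfolding eventually_at_top_linorder by blast
  define R1 where "R1 = max 1 R"
  have "compact (g ` cball 0 R1)"
    by (intro compact_continuous_image continuous_on_subset[OF entire_continuous[OF hol]]) auto
  then obtain B where B: "B > 0" "\<And>z. cmod z \<le> R1 \<Longrightarrow> cmod (g z) \<le> B"
    using compact_imp_bounded bounded_pos by (metis (no_types, lifting) imageI mem_cball_0)
  have "cmod (g z) \<le> max 1 B * exp (\<epsilon> * cmod z)" for z
  proof (cases "cmod z \<le> R1")
    case True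
    have "cmod (g z) \<le> max 1 B * 1" using B(2)[OF True] by simp
    also have "\<dots> \<le> max 1 B * exp (\<epsilon> * cmod z)" using e by (intro mult_left_mono) auto
    finally show ?thesis .
  next
    case False
    then have z: "cmod z \<ge> 1" "cmod z \<ge> R" by (auto simp: R1_def)
    have "logp g z \<le> 3 * nev_T g (2 * cmod z)" by (rule logp_le_3_nev_T[OF hol]) (use z in auto)
    also have "\<dots> \<le> 3 * (\<epsilon> / 6 * (2 * cmod z))" using z by (intro mult_left_mono R) auto
    finally have "logp g z \<le> \<epsilon> * cmod z" by simp
    then have "cmod (g z) \<le> exp (\<epsilon> * cmod z)" using le_logp[of g z] by (meson exp_le_cancel_iff order_trans)
    also have "\<dots> \<le> max 1 B * exp (\<epsilon> * cmod z)" by (simp add: mult_le_cancel_right1)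
    finally show ?thesis .
  qed
  then show ?thesis using that[of "max 1 B"] by auto
qed

text \<open>By Cauchy's estimate on a circle of radius 20, the equation halves the constant in any bound
  \<open>\<bar>a z\<bar> \<le> C e\<^bsup>\<bar>z\<bar>/20\<^esup>\<close>.\<close>
lemma deriv_eq_shift_imp_zero:
  assumes a: "minimal_type a" and eq: "\<And>z. deriv a z = a (z + 1)"
  shows "a z = 0"
proof -
  have hol: "a holomorphic_on UNIV" using a by (simp add: minimal_type_def)
  obtain C where C: "C > 0" "\<And>z. cmod (a z) \<le> C * exp (1/20 * cmod z)"
    using minimal_type_exp_bound[OF a, of "1/20"] by auto
  \<comment> \<open>Passing from u to u - 1 costs e^(1/20) and the circle of radius 20 costs e;
    after division by 20 the total must be at most 1/2.\<close>
  have e2: "exp (1 + 1/20 :: real) \<le> 10"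
  proof -
    have "exp (1 + 1/20 :: real) \<le> exp (1 + 1)" by simp
    also have "\<dots> = exp 1 * exp (1::real)" by (rule exp_add)
    also have "\<dots> \<le> 3 * 3" using exp_le by (intro mult_mono) auto
    finally show ?thesis by simp
  qed
  have half: "cmod (a u) \<le> D / 2 * exp (1/20 * cmod u)" if D: "D > 0" "\<And>z. cmod (a z) \<le> D * exp (1/20 * cmod z)" for D u
  proof -
    let ?v = "u - 1"
    have "cmod ((deriv ^^ 1) a ?v) \<le> fact 1 * (D * exp (1/20 * (cmod ?v + 20))) / 20 ^ 1"
    proof (rule Cauchy_inequality)
      fix x assume "cmod (?v - x) = 20"
      then have "cmod x \<le> cmod ?v + 20" using norm_triangle_ineq2[of x ?v] by (simp add: norm_minus_commute)
      then have "D * exp (1/20 * cmod x) \<le> D * exp (1/20 * (cmod ?v + 20))" using D(1) by simp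
      with D(2)[of x] show "cmod (a x) \<le> D * exp (1/20 * (cmod ?v + 20))" by linarith
    qed (use hol in \<open>auto intro: holomorphic_on_subset holomorphic_on_imp_continuous_on\<close>)
    then have "cmod (a u) \<le> D * exp (1/20 * (cmod ?v + 20)) / 20" using eq[of ?v] by simp
    also have "\<dots> \<le> D * exp ((1 + 1/20) + 1/20 * cmod u) / 20"
      using D(1) norm_triangle_ineq4[of u 1] by simp
    also have "\<dots> = D * (exp (1 + 1/20) * exp (1/20 * cmod u)) / 20" by (simp only: exp_add)
    also have "\<dots> \<le> D * (10 * exp (1/20 * cmod u)) / 20"
      using D(1) e2 by (intro divide_right_mono mult_left_mono mult_right_mono) auto
    finally show ?thesis by simp
  qed
  have "\<forall>z. cmod (a z) \<le> C / 2 ^ n * exp (1/20 * cmod z)" for n :: nat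
  proof (induction n)
    case 0
    show ?case using C(2) by simp
  next
    case (Suc n)
    then show ?case using half[of "C / 2 ^ n"] C(1) by (auto simp: field_simps)
  qed
  then have "cmod (a z) \<le> C / 2 ^ n * exp (1/20 * cmod z)" for n :: nat by blast
  moreover have "(\<lambda>n::nat. C / 2 ^ n * exp (1/20 * cmod z)) \<longlonglongrightarrow> 0" by real_asymp
  ultimately have "cmod (a z) \<le> 0" by (intro LIMSEQ_le_const) auto
  then show ?thesis by simp
qed

lemma logarithmic_growth_imp_polynomial:
  assumes f: "f holomorphic_on UNIV" and growth: "eventually (\<lambda>r. nev_T f r \<le> C * (1 + ln r)) at_top"
  obtains p where "\<And>z. f z = poly p z"
proof -
  obtain R where R: "\<And>r. r \<ge> R \<Longrightarrow> nev_T f r \<le> C * (1 + ln r)"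
    using growth unfolding eventually_at_top_linorder by blast
  define D where "D = max 0 C"
  obtain n :: nat where n: "3 * D \<le> real n" using real_arch_simple by blast
  have bound: "cmod (f z) \<le> exp (3 * D * (1 + ln 2)) * cmod z ^ n" if z: "max 1 R \<le> cmod z" for z
  proof -
    have z1: "cmod z \<ge> 1" "cmod z > 0" "R \<le> 2 * cmod z" using z by auto
    have "logp f z \<le> 3 * nev_T f (2 * cmod z)" by (rule logp_le_3_nev_T[OF f]) (use z1 in auto)
    also have "\<dots> \<le> 3 * (C * (1 + ln (2 * cmod z)))" using z1 by (intro mult_left_mono R) auto
    also have "\<dots> \<le> 3 * (D * (1 + ln (2 * cmod z)))"
      using z1 by (intro mult_left_mono mult_right_mono) (auto simp: D_def intro!: add_nonneg_nonneg ln_ge_zero)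
    also have "\<dots> = 3 * D * (1 + ln 2) + 3 * D * ln (cmod z)" using z1 by (simp add: ln_mult algebra_simps)
    also have "\<dots> \<le> 3 * D * (1 + ln 2) + real n * ln (cmod z)" using n z1 by (intro add_left_mono mult_right_mono) auto
    finally have "exp (logp f z) \<le> exp (3 * D * (1 + ln 2)) * exp (real n * ln (cmod z))" by (simp flip: exp_add)
    also have "exp (real n * ln (cmod z)) = cmod z ^ n" using z1 by (simp add: exp_of_nat_mult)
    finally show ?thesis using le_logp[of f z] by linarith
  qed
  have "f z = poly (\<Sum>k\<le>n. monom ((deriv ^^ k) f 0 / fact k) k) z" for z
    unfolding poly_sum poly_monom by (rule Liouville_polynomial[OF f bound])
  then show ?thesis by (rule that)
qed

text \<open>T(f) is controlled by T(f - a), which is logarithmic here. This excludes a constant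
  exponent h for transcendental f.\<close>

lemma polynomial_if_small_difference_polynomial:
  assumes a: "a holomorphic_on UNIV" and f: "f holomorphic_on UNIV" and sf: "small_function a f"
    and fa: "\<And>z. f z - a z = poly q z"
  obtains p where "\<And>z. f z = poly p z"
proof -
  obtain m where m: "m > 0" "eventually (\<lambda>r. nev_T f r \<le> 2 * nev_T (\<lambda>z. f z - a z) (r + m) + 2 * ln 2) at_top"
    using nev_T_le_difference[OF a f sf] by blast
  obtain C where C: "C \<ge> 0" "\<And>r. 1 \<le> r \<Longrightarrow> nev_T (poly q) r \<le> C * (1 + ln r)" using nev_T_poly by blast
  have eq: "(\<lambda>z. f z - a z) = poly q" using fa by auto
  have "eventually (\<lambda>r. 2 * (C * (1 + ln (r + m))) + 2 * ln 2 \<le> (2 * C + 1) * (1 + ln r)) at_top"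
    using C(1) by real_asymp
  with m(2) have "eventually (\<lambda>r. nev_T f r \<le> (2 * C + 1) * (1 + ln r)) at_top"
    using eventually_ge_at_top[of 1]
  proof eventually_elim
    case (elim r)
    then show ?case using C(2)[of "r + m"] m(1) unfolding eq by simp
  qed
  from logarithmic_growth_imp_polynomial[OF f this] that show ?thesis by blast
qed

text \<open>Passes from smallness relative to f, with exceptional sets, to smallness relative to
  \<open>w\<close> along the radii. The shifts \<open>k\<close> and \<open>m\<close> caused by the
  two sets are harmless because comparability covers every fixed shift.\<close>

lemma (in doubling_exponential) small_function_imp_small:
  assumes a: "a holomorphic_on UNIV" and f: "f holomorphic_on UNIV" and g: "g holomorphic_on UNIV"
    and sf: "small_function a f" "small_function g f" and cmp: "comparable (\<lambda>z. f z - a z)"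
  shows "small g"
  unfolding small_def
proof (intro conjI allI impI g)
  fix K \<epsilon> :: real assume K: "K \<ge> 0" and e: "\<epsilon> > 0"
  obtain m where m: "m > 0" "eventually (\<lambda>r. nev_T f r \<le> 2 * nev_T (\<lambda>z. f z - a z) (r + m) + 2 * ln 2) at_top"
    using nev_T_le_difference[OF a f sf(1)] by blast
  obtain k where k: "k > 0" "\<And>\<epsilon>. \<epsilon> > 0 \<Longrightarrow> eventually (\<lambda>r. nev_T g r \<le> \<epsilon> * nev_T f (r + k)) at_top"
    using small_function_nev_T_le[OF g f sf(2)] by blast
  obtain M where M: "\<And>K. K \<ge> 0 \<Longrightarrow> eventually (\<lambda>n. nev_T (\<lambda>z. f z - a z) (\<rho> n + K) \<le> M * T (\<rho> n)) sequentially"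
    using cmp unfolding comparable_def by blast
  define \<eta> where "\<eta> = \<epsilon> / (2 * \<bar>M\<bar> + 1)"
  have \<eta>: "\<eta> > 0" using e by (simp add: \<eta>_def add_nonneg_pos)
  have lim: "filterlim (\<lambda>n. \<rho> n + c) at_top sequentially" for c
    by (rule filterlim_compose[OF _ radius_at_top, of "\<lambda>r. r + c"]) real_asymp
  have 1: "eventually (\<lambda>n. nev_T g (\<rho> n + K) \<le> \<eta> * nev_T f (\<rho> n + K + k)) sequentially"
    by (rule eventually_compose_filterlim[OF k(2)[OF \<eta>] lim])
  have 2: "eventually (\<lambda>n. nev_T f (\<rho> n + (K + k)) \<le> 2 * nev_T (\<lambda>z. f z - a z) (\<rho> n + (K + k) + m) + 2 * ln 2) sequentially"
    by (rule eventually_compose_filterlim[OF m(2) lim])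
  have 3: "eventually (\<lambda>n. nev_T (\<lambda>z. f z - a z) (\<rho> n + (K + k + m)) \<le> M * T (\<rho> n)) sequentially"
    by (rule M) (use K k m in auto)
  show "eventually (\<lambda>n. nev_T g (\<rho> n + K) \<le> \<epsilon> * T (\<rho> n)) sequentially"
    using 1 2 3 eventually_const_dominated[OF zero_less_one, of "2 * ln 2"]
  proof eventually_elim
    case (elim n)
    have "M * T (\<rho> n) \<le> \<bar>M\<bar> * T (\<rho> n)" by (intro mult_right_mono) auto
    with elim have "nev_T f (\<rho> n + K + k) \<le> (2 * \<bar>M\<bar> + 1) * T (\<rho> n)" by (simp add: algebra_simps)
    then have "\<eta> * nev_T f (\<rho> n + K + k) \<le> \<eta> * ((2 * \<bar>M\<bar> + 1) * T (\<rho> n))" using \<eta> by (intro mult_left_mono) auto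
    also have "\<dots> = \<epsilon> * T (\<rho> n)" by (simp add: \<eta>_def)
    finally show ?case using elim by linarith
  qed
qed

subsection \<open>The difference equation for the polynomial factor\<close>

text \<open>Differentiation preserves the equation and lowers the degree by one, so only degree 2
  has to be refuted by hand: the values at 0 and 1 give \<beta> = 1 and then a zero leading
  coefficient.\<close>

lemma polynomial_difference_equation_degree:
  fixes p :: "complex poly"
  assumes "\<beta> \<noteq> 0" "pderiv p + smult \<beta> p = smult \<beta> (pcompose p [:1, 1:])"
  shows "degree p \<le> 1 \<and> (degree p = 1 \<longrightarrow> \<beta> = 1)"
  using assms(2)
proof (induction "degree p" arbitrary: p rule: less_induct)
  case less
  have ev: "poly (pderiv p) z + \<beta> * poly p z = \<beta> * poly p (z + 1)" for z
    using arg_cong[OF less.prems, of "\<lambda>q. poly q z"] by (simp add: poly_pcompose add.commute)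
  consider "degree p = 0" | "degree p = 1" | "degree p = 2" | "degree p \<ge> 3" by linarith
  then show ?case
  proof cases
    case 2
    obtain c d where p: "p = [:c, d:]" using degree1_coeffs[OF 2] by blast
    with 2 have "d \<noteq> 0" by (auto split: if_splits)
    with ev[of 0] show ?thesis by (simp add: p pderiv_pCons algebra_simps)
  next
    case 3
    obtain c d e where p: "p = [:c, d, e:]" using degree2_coeffs[OF 3] by metis
    with 3 have e: "e \<noteq> 0" by (auto split: if_splits)
    have 0: "d = \<beta> * (d + e)" using ev[of 0] by (simp add: p pderiv_pCons algebra_simps)
    have "d + 2 * e = \<beta> * (d + 3 * e)" using ev[of 1] by (simp add: p pderiv_pCons algebra_simps)
    with 0 have "2 * e = \<beta> * (2 * e)" by algebra
    then have "\<beta> = 1" using e by simp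
    with 0 e show ?thesis by simp
  next
    case 4
    have "pderiv (pderiv p + smult \<beta> p) = pderiv (smult \<beta> (pcompose p [:1, 1:]))" using less.prems by simp
    then have "pderiv (pderiv p) + smult \<beta> (pderiv p) = smult \<beta> (pcompose (pderiv p) [:1, 1:])"
      by (simp add: pderiv_add pderiv_smult pderiv_pcompose pderiv_pCons)
    moreover have d: "degree (pderiv p) = degree p - 1" by (rule degree_pderiv)
    moreover have "degree (pderiv p) < degree p" using d 4 by linarith
    ultimately have "degree (pderiv p) \<le> 1" using less.hyps by blast
    with d 4 show ?thesis by linarith
  qed simp
qed

text \<open>Division by p shows that h' = k p(z+1)/p(z) - p'(z)/p(z) tends to k at infinity, so
  Liouville's theorem applies.\<close>

lemma exponent_derivative_constant:
  fixes p :: "complex poly"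
  assumes h: "h holomorphic_on UNIV" and p: "p \<noteq> 0"
    and eq: "\<And>z. poly (pderiv p) z + poly p z * deriv h z = k * poly p (z + 1)"
  shows "deriv h z = k"
proof (rule Liouville_weak[of "deriv h"])
  show "deriv h holomorphic_on UNIV" using h by (intro holomorphic_intros) auto
  let ?q = "pcompose p [:1, 1:]"
  have deg: "degree ?q = degree p" by (simp add: degree_pcompose)
  have lc: "lead_coeff ?q = lead_coeff p" by (subst lead_coeff_comp) auto
  have "((\<lambda>z. (poly ?q z / z ^ degree ?q) / (poly p z / z ^ degree p)) \<longlongrightarrow> lead_coeff ?q / lead_coeff p) at_infinity"
    using p by (intro tendsto_divide poly_divide_tendsto_aux) auto
  then have 1: "((\<lambda>z. (poly ?q z / z ^ degree p) / (poly p z / z ^ degree p)) \<longlongrightarrow> 1) at_infinity"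
    using p unfolding lc unfolding deg by simp
  have 2: "((\<lambda>z. poly (pderiv p) z / poly p z) \<longlongrightarrow> 0) at_infinity"
  proof (cases "degree p = 0")
    case True
    then have "pderiv p = 0" by (simp add: pderiv_eq_0_iff)
    then show ?thesis by simp
  next
    case False
    then show ?thesis by (intro poly_divide_tendsto_0_at_infinity) (simp add: degree_pderiv)
  qed
  have "((\<lambda>z. k * ((poly ?q z / z ^ degree p) / (poly p z / z ^ degree p)) - poly (pderiv p) z / poly p z) \<longlongrightarrow> k * 1 - 0) at_infinity"
    by (intro tendsto_intros 1 2)
  moreover have "eventually (\<lambda>z. k * ((poly ?q z / z ^ degree p) / (poly p z / z ^ degree p)) - poly (pderiv p) z / poly p z = deriv h z) at_infinity"
  proof -
    have "finite {z. poly p z = 0}" using p by (rule poly_roots_finite)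
    then obtain B where "B > 0" and B: "\<forall>z\<in>{z. poly p z = 0}. cmod z \<le> B"
      using finite_imp_bounded bounded_pos by metis
    show ?thesis
    proof (rule eventually_at_infinityI[of "B + 1"])
      fix z :: complex assume "B + 1 \<le> cmod z"
      then have "poly p z \<noteq> 0" "z \<noteq> 0" using B \<open>B > 0\<close> by force+
      moreover have "poly ?q z = poly p (z + 1)" by (simp add: poly_pcompose add.commute)
      ultimately show "k * ((poly ?q z / z ^ degree p) / (poly p z / z ^ degree p)) - poly (pderiv p) z / poly p z = deriv h z"
        using eq[of z] by (simp add: field_simps)
    qed
  qed
  ultimately show "(deriv h \<longlongrightarrow> k) at_infinity" by (simp add: tendsto_cong)
qed

subsection \<open>Proof of the theorem\<close>

lemma share_CM_quotient:
  assumes F: "F holomorphic_on UNIV" and G: "G holomorphic_on UNIV" and b: "b holomorphic_on UNIV"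
    and share: "share_CM F G b"
  obtains E where "E holomorphic_on UNIV" "\<And>z. E z \<noteq> 0" "\<And>z. F z - b z = E z * (G z - b z)"
proof (rule holomorphic_zorder_factorization[of "\<lambda>z. F z - b z" UNIV "\<lambda>z. G z - b z"])
  show Fb: "(\<lambda>z. F z - b z) holomorphic_on UNIV" and Gb: "(\<lambda>z. G z - b z) holomorphic_on UNIV"
    by (intro holomorphic_intros F G b)+
  show iff: "G z - b z = 0 \<longleftrightarrow> F z - b z = 0" for z using share unfolding share_CM_def by blast
  show "zorder (\<lambda>z. G z - b z) z = zorder (\<lambda>z. F z - b z) z" for z
  proof (cases "F z - b z = 0")
    case True
    then show ?thesis using share unfolding share_CM_def by auto
  next
    \<comment> \<open>Sharing CM speaks only about common zeros; elsewhere both orders are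
      0.\<close>
    case False
    moreover have "(\<lambda>z. F z - b z) analytic_on {z}" "(\<lambda>z. G z - b z) analytic_on {z}"
      unfolding analytic_on_holomorphic using Fb Gb by auto
    ultimately have "zorder (\<lambda>z. F z - b z) z = 0" "zorder (\<lambda>z. G z - b z) z = 0"
      using iff[of z] by (auto intro: zorder_eq_0I)
    then show ?thesis by simp
  qed
qed (use that in auto)

lemma deriv_poly_times_exp:
  assumes h: "h holomorphic_on UNIV"
  shows "deriv (\<lambda>z. poly p z * exp (h z)) z = (poly (pderiv p) z + poly p z * deriv h z) * exp (h z)"
proof (rule DERIV_imp_deriv)
  have "(h has_field_derivative deriv h z) (at z)" using h by (auto intro: holomorphic_derivI)
  then show "((\<lambda>z. poly p z * exp (h z)) has_field_derivative (poly (pderiv p) z + poly p z * deriv h z) * exp (h z)) (at z)"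
    by (auto intro!: derivative_eq_intros simp: algebra_simps)
qed

theorem theorem2:
  fixes f a b :: "complex \<Rightarrow> complex"
  assumes "transcendental_entire f"
    and "nev_hyper_order f < 1"
    and "entire a" and "entire b"
    and "small_function a f" and "small_function b f"
    and "nev_order a < nev_order f"
    and "gen_picard_exceptional a f"
    and "share_CM (deriv f) (\<lambda>z. f (z + 1)) b"
  shows "\<exists>(\<beta>::complex) (p::complex poly).
    \<beta> \<noteq> 0 \<and> p \<noteq> 0 \<and> degree p \<le> 1 \<and>
    (\<forall>z. f z = a z + poly p z * exp (\<beta> * z)) \<and>
    (\<exists>z. f (z + 1) - b z \<noteq> 0) \<and>
    (\<forall>z. deriv f z - b z = (\<beta> / exp \<beta>) * (f (z + 1) - b z)) \<and>
    (degree p = 1 \<longrightarrow> \<beta> = 1) \<and>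
    (((\<forall>z. a (z + 1) = b z) \<and> (\<forall>z. a z = 0) \<and> (\<forall>z. b z = 0)) \<or>
     ((\<exists>z. a (z + 1) \<noteq> b z) \<and>
      (\<forall>z. deriv a z - b z = (\<beta> / exp \<beta>) * (a (z + 1) - b z)) \<and>
      (\<beta> / exp \<beta> = 1 \<longrightarrow> (\<forall>z. a z = 0) \<and> degree p = 0)))"
proof -
  have f: "f holomorphic_on UNIV" and a: "a holomorphic_on UNIV" and b: "b holomorphic_on UNIV"
    and trans: "\<not> (\<exists>p. \<forall>z. f z = poly p z)"
    using assms unfolding transcendental_entire_def entire_def by auto
  have shift: "(\<lambda>z. g (z + 1)) holomorphic_on UNIV" if "g holomorphic_on UNIV" for g :: "complex \<Rightarrow> complex"
    by (intro holomorphic_on_compose[OF _ holomorphic_on_subset[OF that], unfolded o_def] holomorphic_intros) auto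
  have fa: "(\<lambda>z. f z - a z) holomorphic_on UNIV" by (intro holomorphic_intros f a)
  obtain p Y where p: "p \<noteq> 0" and Y: "Y holomorphic_on UNIV" "\<forall>z. Y z \<noteq> 0" "\<forall>z. f z - a z = poly p z * Y z"
    using entire_finite_zeros_factor[OF fa] assms(8) unfolding gen_picard_exceptional_def by blast
  obtain h where h: "h holomorphic_on UNIV" "\<And>z. exp (h z) = Y z"
    using holomorphic_logarithm_exists[of UNIV Y 0] Y by auto
  have f_eq: "f z = a z + poly p z * exp (h z)" for z using Y(3) h(2) by (simp add: algebra_simps)
  have fa_eq: "(\<lambda>z. f z - a z) = (\<lambda>z. poly p z * exp (h z))" by (simp add: f_eq)
  \<comment> \<open>With h constant, f - a would be a polynomial and hence f too, against
    transcendence.\<close>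
  have "\<exists>x. deriv h x \<noteq> 0"
  proof (rule ccontr)
    assume "\<not> ?thesis"
    moreover have "(h has_field_derivative deriv h z) (at z)" for z
      using h by (auto intro: holomorphic_derivI)
    ultimately have "\<exists>c. \<forall>x\<in>UNIV. h x = c" by (intro has_field_derivative_zero_constant) auto
    then obtain c where c: "\<And>z. h z = c" by blast
    have "f z - a z = poly (smult (exp c) p) z" for z by (simp add: f_eq c)
    from polynomial_if_small_difference_polynomial[OF a f assms(5) this] trans show False by metis
  qed
  then obtain z0 where z0: "deriv h z0 \<noteq> 0" by blast
  \<comment> \<open>e^h is (f - a)/p, and T(a) is eventually at most T(f) at radius r + m. Using the
    rate \<delta>/2 for f leaves room for this shift and the remaining terms.\<close>
  have growth: "eventually (\<lambda>r. nev_T (\<lambda>z. exp (h z)) r \<le> exp (\<delta> * r)) at_top" if d: "\<delta> > 0" for \<delta>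
  proof -
    obtain x where x: "poly p x \<noteq> 0" using p by (metis poly_all_0_iff_0)
    have eh: "(\<lambda>z. exp (h z)) holomorphic_on UNIV" by (intro holomorphic_intros h)
    have ph: "poly p holomorphic_on UNIV" by (intro holomorphic_intros)
    obtain C where C: "\<And>r. 1 \<le> r \<Longrightarrow> nev_T (\<lambda>z. exp (h z)) r \<le> nev_T (\<lambda>z. exp (h z) * poly p z) r + nev_T (poly p) r + C"
      using nev_T_quotient[OF eh ph x] by blast
    obtain D where D: "\<And>r. 1 \<le> r \<Longrightarrow> nev_T (poly p) r \<le> D * (1 + ln r)" using nev_T_poly by blast
    obtain m where m: "m > 0" "\<And>\<epsilon>. \<epsilon> > 0 \<Longrightarrow> eventually (\<lambda>r. nev_T a r \<le> \<epsilon> * nev_T f (r + m)) at_top"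
      using small_function_nev_T_le[OF a f assms(5)] by blast
    have half: "\<delta> / 2 > 0" using d by simp
    have "filterlim (\<lambda>r. r + m) at_top at_top" by real_asymp
    then have "eventually (\<lambda>r. nev_T f (r + m) \<le> exp (\<delta> / 2 * (r + m))) at_top"
      using hyper_order_less_one_growth[OF assms(2) half] by (rule eventually_compose_filterlim[rotated])
    moreover have "eventually (\<lambda>r. 2 * exp (\<delta> / 2 * (r + m)) + ln 2 + D * (1 + ln r) + C \<le> exp (\<delta> * r)) at_top"
      using d by real_asymp
    ultimately show ?thesis using m(2)[OF zero_less_one] eventually_ge_at_top[of 1]
    proof eventually_elim
      case (elim r)
      have "nev_T (\<lambda>z. exp (h z) * poly p z) r = nev_T (\<lambda>z. f z + - a z) r"
        by (simp add: f_eq mult.commute)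
      also have "\<dots> \<le> nev_T f r + nev_T (\<lambda>z. - a z) r + ln 2"
        using elim by (intro nev_T_add holomorphic_intros f a) auto
      also have "nev_T (\<lambda>z. - a z) r = nev_T a r" by (rule nev_T_minus)
      also have "nev_T f r \<le> nev_T f (r + m)" using elim m by (intro nev_T_mono f) auto
      finally show ?case using C[of r] D[of r] elim by simp
    qed
  qed
  obtain \<rho> :: "nat \<Rightarrow> real" where "\<And>n. real n + 1 \<le> \<rho> n"
    "\<And>n. nev_T (\<lambda>z. exp (h z)) (\<rho> n + real n) \<le> 2 * nev_T (\<lambda>z. exp (h z)) (\<rho> n)"
    using doubling_radii[OF h(1) z0 growth] by blast
  then interpret doubling_exponential h \<rho> z0
    using h(1) z0 by unfold_locales auto
  have cmp: "comparable (\<lambda>z. f z - a z)"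
    unfolding fa_eq by (rule comparable_mult[OF small_imp_comparable[OF small_poly] comparable_w])
  have sa: "small a" by (rule small_function_imp_small[OF a f a assms(5,5) cmp])
  have sb: "small b" by (rule small_function_imp_small[OF a f b assms(5,6) cmp])
  have sh: "small (deriv h)" by (rule small_deriv_exponent[OF h(1) comparable_w])
  obtain E where E: "E holomorphic_on UNIV" "\<And>z. E z \<noteq> 0" "\<And>z. deriv f z - b z = E z * (f (z + 1) - b z)"
    using share_CM_quotient[OF _ shift[OF f] b assms(9)] f by (auto intro: holomorphic_intros)
  define A where "A z = deriv a z - b z" for z
  define B where "B z = a (z + 1) - b z" for z
  define P1 where "P1 z = poly (pderiv p) z + poly p z * deriv h z" for z
  define P2 where "P2 z = poly (pcompose p [:1, 1:]) z * exp (h (z + 1) - h z)" for z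
  have P2_eq: "P2 z = poly p (z + 1) * exp (h (z + 1) - h z)" for z
    by (simp add: P2_def poly_pcompose add.commute)
  have small: "small A" "small B" "small P1" "small P2"
    unfolding A_def [abs_def] B_def [abs_def] P1_def [abs_def] P2_def [abs_def]
    by (intro small_diff small_add small_mult small_deriv small_shift small_poly sa sb sh small_exp_difference)+
  have df: "deriv f z = deriv a z + P1 z * w z" for z
  proof -
    have "deriv f z = deriv (\<lambda>z. a z + poly p z * exp (h z)) z" by (rule arg_cong[of _ _ "\<lambda>g. deriv g z"]) (auto simp: f_eq)
    also have "\<dots> = deriv a z + deriv (\<lambda>z. poly p z * exp (h z)) z"
      using a h(1) by (intro deriv_add) (auto intro!: holomorphic_on_imp_differentiable_at[of _ UNIV] holomorphic_intros)
    finally show ?thesis by (simp add: deriv_poly_times_exp[OF h(1)] P1_def)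
  qed
  have fs: "f (z + 1) - b z = B z + P2 z * w z" for z
    by (simp add: f_eq B_def P2_eq exp_diff)
  have eq: "A z + P1 z * w z = E z * (B z + P2 z * w z)" for z
    using E(3)[of z] unfolding df fs by (simp add: A_def algebra_simps)
  obtain x where x: "poly p x \<noteq> 0" using p by (metis poly_all_0_iff_0)
  then have x2: "P2 (x - 1) \<noteq> 0" by (simp add: P2_eq)
  \<comment> \<open>Otherwise p e^h has derivative 0 and is constant, which contradicts the
    independence of 1 and \<open>w\<close>.\<close>
  have "\<exists>x1. P1 x1 \<noteq> 0"
  proof (rule ccontr)
    assume "\<not> ?thesis"
    then have P10: "P1 z = 0" for z by blast
    have D: "((\<lambda>z. poly p z * w z) has_field_derivative 0) (at z)" for z
    proof -
      have "(\<lambda>z. poly p z * w z) holomorphic_on UNIV" by (intro holomorphic_intros h)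
      then have "((\<lambda>z. poly p z * w z) has_field_derivative deriv (\<lambda>z. poly p z * w z) z) (at z)"
        by (auto intro: holomorphic_derivI)
      then show ?thesis using P10[of z] by (simp add: deriv_poly_times_exp[OF h(1)] P1_def)
    qed
    have "\<exists>c. \<forall>z\<in>UNIV. poly p z * w z = c"
      by (rule has_field_derivative_zero_constant[of UNIV "\<lambda>z. poly p z * w z"]) (auto intro: D)
    then obtain c where "\<And>z. poly p z * w z = c" by blast
    then have "- c + poly p z * w z = 0" for z by simp
    from small_linear_independent(2)[OF small_const small_poly this] x show False by simp
  qed
  then obtain x1 where x1: "P1 x1 \<noteq> 0" by blast
  have ratio: "P1 z = E z * P2 z" "A z = E z * B z" for z
    using shared_value_ratio[OF small x1 x2 E(1,2) eq] by auto
  text \<open>The zero-free factor \<open>V\<close> inherits the growth of \<open>h'\<close>, so it is constant.\<close>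
  define V where "V z = E z * exp (h (z + 1) - h z)" for z
  have V: "V holomorphic_on UNIV" "\<And>z. V z \<noteq> 0"
    unfolding V_def using E(2) by (auto intro!: holomorphic_intros E h shift)
  obtain S where S: "S holomorphic_on UNIV" "\<And>z. exp (S z) = V z"
    using holomorphic_logarithm_exists[of UNIV V 0] V by auto
  have eS: "(\<lambda>z. exp (S z)) = V" using S(2) by auto
  have P1V: "P1 z = V z * poly (pcompose p [:1, 1:]) z" for z by (simp add: ratio V_def P2_def)
  \<comment> \<open>P1 = p' + p h' has characteristic o(r), and dividing it by p(z+1) to obtain V
    costs only O(ln r).\<close>
  have mP1: "minimal_type P1"
    unfolding P1_def [abs_def]
    by (intro minimal_type_add minimal_type_mult minimal_type_poly minimal_type_deriv_exponent h growth)
  obtain \<kappa> where \<kappa>: "\<And>z. V z = \<kappa>"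
  proof -
    have pc: "poly (pcompose p [:1, 1:]) holomorphic_on UNIV" by (intro holomorphic_intros)
    have "poly (pcompose p [:1, 1:]) (x - 1) \<noteq> 0" using x by (simp add: poly_pcompose)
    then obtain C where C: "\<And>r. 1 \<le> r \<Longrightarrow> nev_T V r \<le> nev_T (\<lambda>z. V z * poly (pcompose p [:1, 1:]) z) r + nev_T (poly (pcompose p [:1, 1:])) r + C"
      using nev_T_quotient[OF V(1) pc] by blast
    have "eventually (\<lambda>r. nev_T (\<lambda>z. exp (S z)) r \<le> \<delta> * r) at_top" if d: "\<delta> > 0" for \<delta>
    proof -
      have d3: "\<delta> / 3 > 0" using d by simp
      have "eventually (\<lambda>r. nev_T P1 r \<le> \<delta> / 3 * r) at_top"
        "eventually (\<lambda>r. nev_T (poly (pcompose p [:1, 1:])) r \<le> \<delta> / 3 * r) at_top"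
        using mP1 minimal_type_poly d3 unfolding minimal_type_def by blast+
      moreover have "eventually (\<lambda>r. C \<le> \<delta> / 3 * r) at_top" using d by real_asymp
      ultimately show ?thesis using eventually_ge_at_top[of 1]
      proof eventually_elim
        case (elim r)
        then show ?case using C[of r] unfolding eS P1V[symmetric] by simp
      qed
    qed
    from exponent_constant[OF S(1) this] obtain c where "\<And>z. S z = c" by blast
    then show ?thesis using that[of "exp c"] S(2) by metis
  qed
  define \<beta> where "\<beta> = \<kappa>"
  have \<beta>: "\<beta> \<noteq> 0" using V(2)[of 0] \<kappa> by (simp add: \<beta>_def)
  have hode: "poly (pderiv p) z + poly p z * deriv h z = \<beta> * poly p (z + 1)" for z
    using P1V[of z] by (simp add: P1_def \<kappa> \<beta>_def poly_pcompose add.commute)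
  have h': "deriv h z = \<beta>" for z by (rule exponent_derivative_constant[OF h(1) p hode])
  have "\<exists>c. \<forall>z\<in>UNIV. h z - \<beta> * z = c"
  proof (rule has_field_derivative_zero_constant[of UNIV "\<lambda>z. h z - \<beta> * z"])
    fix z
    have "(h has_field_derivative deriv h z) (at z)" using h by (auto intro: holomorphic_derivI)
    then show "((\<lambda>z. h z - \<beta> * z) has_field_derivative 0) (at z within UNIV)"
      by (auto intro!: derivative_eq_intros simp: h')
  qed auto
  then obtain c where "\<And>z. h z - \<beta> * z = c" by blast
  then have hc: "h z = \<beta> * z + c" for z by (metis add.commute diff_add_cancel)
  have E_eq: "E z = \<beta> / exp \<beta>" for z
    using \<kappa>[of z] by (simp add: V_def hc \<beta>_def field_simps)
  have "poly (pderiv p + smult \<beta> p) = poly (smult \<beta> (pcompose p [:1, 1:]))"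
    using hode h' by (intro ext) (simp add: poly_pcompose add.commute mult.commute)
  then have "pderiv p + smult \<beta> p = smult \<beta> (pcompose p [:1, 1:])"
    by (simp only: poly_eq_poly_eq_iff)
  note deg = polynomial_difference_equation_degree[OF \<beta> this]
  \<comment> \<open>The factor e^c of e^h = e^c e^(\<beta> z) goes into the polynomial.\<close>
  define q where "q = smult (exp c) p"
  have q: "q \<noteq> 0" "degree q = degree p" using p by (auto simp: q_def)
  \<comment> \<open>Now that h is linear, T(f - a) is O(r), hence so is T(f), and a is small
    compared with f.\<close>
  have a_min: "minimal_type a"
    unfolding minimal_type_def
  proof (intro conjI allI impI a)
    fix \<delta> :: real assume d: "\<delta> > 0"
    obtain m where m: "m > 0" "eventually (\<lambda>r. nev_T f r \<le> 2 * nev_T (\<lambda>z. f z - a z) (r + m) + 2 * ln 2) at_top"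
      using nev_T_le_difference[OF a f assms(5)] by blast
    obtain k where k: "k > 0" "\<And>\<epsilon>. \<epsilon> > 0 \<Longrightarrow> eventually (\<lambda>r. nev_T a r \<le> \<epsilon> * nev_T f (r + k)) at_top"
      using small_function_nev_T_le[OF a f assms(5)] by blast
    obtain D where D: "\<And>r. 1 \<le> r \<Longrightarrow> nev_T (poly p) r \<le> D * (1 + ln r)" using nev_T_poly by blast
    have fa_le: "nev_T (\<lambda>z. f z - a z) r \<le> D * (1 + ln r) + (cmod \<beta> * r + cmod c)" if r: "1 \<le> r" for r
    proof -
      have "nev_T w r \<le> cmean (\<lambda>z. cmod \<beta> * r + cmod c) 0 r"
        unfolding nev_T_eq_cmean
      proof (rule cmean_mono)
        fix z :: complex assume z: "cmod (z - 0) = r"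
        have "Re (h z) \<le> cmod (\<beta> * z + c)" unfolding hc by (rule complex_Re_le_cmod)
        also have "\<dots> \<le> cmod \<beta> * r + cmod c" using norm_triangle_ineq[of "\<beta> * z" c] z by (simp add: norm_mult)
        finally show "logp w z \<le> cmod \<beta> * r + cmod c" using r by (simp add: logp_exp)
      qed (use r in \<open>auto intro!: continuous_intros w_holomorphic\<close>)
      moreover have "nev_T (\<lambda>z. poly p z * w z) r \<le> nev_T (poly p) r + nev_T w r"
        using r by (intro nev_T_mult w_holomorphic holomorphic_intros) auto
      ultimately show ?thesis using D[OF r] by (simp add: fa_eq cmean_const)
    qed
    \<comment> \<open>2 |\<beta>| is the leading coefficient of the bound for T(f); the extra 2
      absorbs all lower terms.\<close>
    define M where "M = 2 * (cmod \<beta> + 1)"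
    have M: "M > 0" by (simp add: M_def add_nonneg_pos)
    have "eventually (\<lambda>r. 2 * (D * (1 + ln (r + k + m)) + (cmod \<beta> * (r + k + m) + cmod c)) + 2 * ln 2 \<le> M * r) at_top"
      unfolding M_def by real_asymp
    moreover have "filterlim (\<lambda>r. r + k) at_top at_top" by real_asymp
    then have "eventually (\<lambda>r. nev_T f (r + k) \<le> 2 * nev_T (\<lambda>z. f z - a z) (r + k + m) + 2 * ln 2) at_top"
      by (rule eventually_compose_filterlim[OF m(2)])
    moreover have "\<delta> / M > 0" using d M by simp
    then have "eventually (\<lambda>r. nev_T a r \<le> \<delta> / M * nev_T f (r + k)) at_top" by (rule k(2))
    ultimately show "eventually (\<lambda>r. nev_T a r \<le> \<delta> * r) at_top" using eventually_ge_at_top[of 1]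
    proof eventually_elim
      case (elim r)
      have "nev_T f (r + k) \<le> M * r" using elim fa_le[of "r + k + m"] k m by simp
      then have "\<delta> / M * nev_T f (r + k) \<le> \<delta> / M * (M * r)" using d M by (intro mult_left_mono) auto
      then show ?case using elim M by simp
    qed
  qed
  have a_zero: "a z = 0" if "\<And>z. deriv a z = a (z + 1)" for z
    by (rule deriv_eq_shift_imp_zero[OF a_min that])
  have ratio': "deriv a z - b z = (\<beta> / exp \<beta>) * (a (z + 1) - b z)" for z
    using ratio(2)[of z] by (simp add: A_def B_def E_eq)
  have "\<exists>z. f (z + 1) - b z \<noteq> 0"
  proof (rule ccontr)
    assume "\<not> ?thesis"
    then have "B z + P2 z * w z = 0" for z unfolding fs by blast
    from small_linear_independent(2)[OF small(2,4) this] x2 show False by simp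
  qed
  moreover have "((\<forall>z. a (z + 1) = b z) \<and> (\<forall>z. a z = 0) \<and> (\<forall>z. b z = 0)) \<or>
     ((\<exists>z. a (z + 1) \<noteq> b z) \<and>
      (\<forall>z. deriv a z - b z = (\<beta> / exp \<beta>) * (a (z + 1) - b z)) \<and>
      (\<beta> / exp \<beta> = 1 \<longrightarrow> (\<forall>z. a z = 0) \<and> degree q = 0))"
  \<comment> \<open>Both a(z+1) = b and \<beta> / e^\<beta> = 1 turn \<open>ratio'\<close> into
    a'(z) = a(z+1), which forces a = 0.\<close>
  proof (cases "\<forall>z. a (z + 1) = b z")
    case True
    then have "deriv a z = a (z + 1)" for z using ratio'[of z] by simp
    then have "a z = 0" for z by (rule a_zero)
    moreover from this True have "b z = 0" for z by metis
    ultimately show ?thesis using True by blast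
  next
    case False
    have "(\<forall>z. a z = 0) \<and> degree q = 0" if 1: "\<beta> / exp \<beta> = 1"
    proof
      have "deriv a z = a (z + 1)" for z using ratio'[of z] unfolding 1 by simp
      then show "\<forall>z. a z = 0" using a_zero by blast
      \<comment> \<open>Degree 1 would force \<beta> = 1, but then \<beta> / e^\<beta> is 1/e and
        not 1.\<close>
      have "exp (1::real) \<noteq> 1" by simp
      then have "\<beta> \<noteq> 1" using 1 by (auto simp: field_simps exp_eq_1)
      then show "degree q = 0" using deg q(2) by linarith
    qed
    with False ratio' show ?thesis by blast
  qed
  ultimately show ?thesis
    using \<beta> q deg E(3)
    by (intro exI[of _ \<beta>] exI[of _ q]) (auto simp: q_def f_eq hc exp_add E_eq)
qed

end
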